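(* Let $X$ be a separable Banach space and $\alpha \in (0,\omega_1)$. Assume that $Y$ is a Banach space and that $Y$ bi-Lipschitz embeds into $X$. Then (1) $ST(X)>\alpha$ if and only if $D_\alpha^\omega$ sub-Lipschitz embeds into $X$. (2) $ST(Y)\le ST(X)$. (3) If $X$ fails the Infinite Sprawling Tree Property, so does $Y$.
   Context: All Banach spaces are real; $B_X$ is the closed unit ball. $\omega=\{0,1,2,\dots\}$, $\omega_1$ is the first uncountable ordinal. For every limit ordinal $\alpha<\omega_1$ fix once and for all an enumeration $(\beta_n)_{n\in\omega}$ of all ordinals less than $\alpha$. For finite sequences $s,t$, $s\cdot t$ denotes their concatenation ($s$ followed by $t$); a single element $a$ (such as a pair $(0,n)$ or $(1,n)$) is identified with the one-term sequence consisting of $a$, and $a\cdot S=\{a\cdot t:t\in S\}$ for a set $S$ of finite sequences. **Sprawling trees.** Sets $S_\alpha$ ($\alpha<\omega_1$) of finite sequences in $\{0,1\}\times\omega$ are defined by: $S_0=\{\varnothing\}$; $S_{\alpha+1}=\{\varnothing\}\cup\bigcup_{n\in\omega}\big((0,n)\cdot S_\alpha\cup(1,n)\cdot S_\alpha\big)$; for $\alpha$ limit, $S_\alpha=\{\varnothing\}\cup\bigcup_{n\in\omega}(0,n)\cdot S_{\beta_n}$. Every $s\in S_\alpha$ is of one of three types: (A) $s$ has no successor in $S_\alpha$; (B) its successors are all $s\cdot(0,n)$ and all $s\cdot(1,n)$, $n\in\omega$; (C) its successors are exactly all $s\cdot(0,n)$, $n\in\omega$. For $\delta>0$, a $\delta$-$\alpha$-sprawling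 tree in $X$ is a family $(x_s)_{s\in S_\alpha}\subset X$ such that: if $s$ is of type (B), then $x_s=\frac12(x_{s\cdot(0,n)}+x_{s\cdot(1,n)})$ for all $n\in\omega$ and $\|x_{s\cdot(0,n)}-x_{s\cdot(0,m)}\|\ge\delta$ for all $n\ne m$; if $s$ is of type (C), then $x_s=x_{s\cdot(0,n)}$ for all $n\in\omega$. **Index $ST$.** For separable $X$ and $\delta>0$, $ST(X,\delta)=\inf\{\alpha<\omega_1: B_X\text{ does not contain a }\delta\text{-}\alpha\text{-sprawling tree}\}$ if this set is nonempty, and $ST(X,\delta)=\infty$ otherwise (with $\alpha<\infty$ for all ordinals $\alpha$); $ST(X)=\sup_{\delta>0}ST(X,\delta)$. **Infinite Sprawling Tree Property.** $X$ has it if there exist $\delta>0$ and $f:(\{0,1\}\times\omega)^{<\omega}\to B_X$ (defined on all finite sequences in $\{0,1\}\times\omega$) such that for all $s$: $f(s)=\frac12(f(s\cdot(0,n))+f(s\cdot(1,n)))$ for all $n\in\omega$, and $\|f(s\cdot(0,n))-f(s\cdot(0,m))\|\ge\delta$ for all $n\neq m$. **Countably branching diamonds** ($\kappa=\omega$). Metric spaces $(D_\alpha^\kappa,d_\alpha)$ with distinguished points $t_\alpha$ (top), $b_\alpha$ (bottom), satisfying $d_\alpha(t_\alpha,b_\alpha)=1$, are defined inductively. $D_0^\kappa=\{t_0,b_0\}$ with $d_0(t_0,b_0)=1$. $D_1^\kappa=\{t_1,b_1\}\cup\{x_1^i:0\le i<\kappa\}$ with the complete bipartite graph structure between $\{t_1,b_1\}$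 and $\{x_1^i:i<\kappa\}$, and $d_1$ is $\frac12$ times the shortest path metric. $D_{\alpha+1}^\kappa$ is obtained from $D_1^\kappa$ (the "original $D_1^\kappa$", with points now denoted $t_{\alpha+1},b_{\alpha+1},x_{\alpha+1}^i$) by replacing each edge $\{t_1,x_1^i\}$ by a copy $D_\alpha^{(i,+)}$ of $D_\alpha^\kappa$ whose top is $t_{\alpha+1}$ and whose bottom is $x^i_{\alpha+1}$, and each edge $\{x_1^i,b_1\}$ by a copy $D_\alpha^{(i,-)}$ whose top is $x_{\alpha+1}^i$ and whose bottom is $b_{\alpha+1}$; each copy carries the metric $\frac12 d_\alpha$ and $d_{\alpha+1}$ is the resulting shortest path metric. For $\alpha$ limit, $D_\alpha^\kappa$ is the disjoint union of the $D_{\beta_n}^\kappa$, $n\in\omega$, in which all tops $t_{\beta_n}$ are identified to $t_\alpha$ and all bottoms $b_{\beta_n}$ to $b_\alpha$; $d_\alpha$ equals $d_{\beta_n}$ on each $D_{\beta_n}^\kappa$ and is extended as the shortest path metric. **Active pairs.** $AP_0^\kappa=\{\{t_0,b_0\}\}$; $AP_1^\kappa$ is the set of all two-element subsets of $D_1^\kappa$; $AP_{\alpha+1}^\kappa$ is the union of the set of all two-element subsets of the original $D_1^\kappa$ in $D_{\alpha+1}^\kappa$ and of the active pairs of each copy $D_\alpha^{(i,\pm)}$ of $D_\alpha^\kappa$; for $\alpha$ limit, $AP_\alpha^\kappa=\bigcup_n AP_{\beta_n}^\kappa$. $D_\alpha^\kappa$ *sub-Lipschitz embeds* into $X$ if there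 are $A,B>0$ and $f:D_\alpha^\kappa\to X$ with $A\,d_\alpha(u,v)\le\|f(u)-f(v)\|\le B\,d_\alpha(u,v)$ for all $\{u,v\}\in AP_\alpha^\kappa$. *)

theory Defs
  imports
    "HOL-Analysis.Analysis"
    "HOL-Library.Countable_Set_Type"
    "HOL-Library.Z2"
begin

unbundle cardinal_syntax

section \<open>Countable ordinals\<close>

text \<open>
  The type \<open>omega1\<close> is the set of countable ordinals, i.e. the first uncountable ordinal.
  The two lemmas \<open>countable_below\<close> and \<open>uncountable_omega1\<close> characterise its order type.
\<close>

lemma Card_order_cardSuc_natLeq: "Card_order (cardSuc natLeq)"
  by (rule cardSuc_Card_order[OF natLeq_Card_order])

lemma Well_order_cardSuc_natLeq: "Well_order (cardSuc natLeq)"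
  using Card_order_cardSuc_natLeq unfolding card_order_on_def by blast

lemma natLeq_less_cardSuc: "natLeq <o cardSuc natLeq"
  by (rule cardSuc_greater[OF natLeq_Card_order])

lemma uncountable_Field_cardSuc: "uncountable (Field (cardSuc natLeq))"
proof
  assume "countable (Field (cardSuc natLeq))"
  then have "|Field (cardSuc natLeq)| \<le>o natLeq"
    by (simp add: countable_card_le_natLeq)
  then have "cardSuc natLeq \<le>o natLeq"
    using card_of_Field_ordIso[OF Card_order_cardSuc_natLeq] ordIso_ordLeq_trans ordIso_symmetric
    by blast
  then show False
    using natLeq_less_cardSuc not_ordLess_ordLeq by blast
qed

typedef omega1 = "Field (cardSuc natLeq)"
  using uncountable_Field_cardSuc by (metis countable_empty ex_in_conv)

setup_lifting type_definition_omega1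

instantiation omega1 :: linorder
begin

lift_definition less_eq_omega1 :: "omega1 \<Rightarrow> omega1 \<Rightarrow> bool"
  is "\<lambda>a b. (a, b) \<in> cardSuc natLeq" .

definition less_omega1 :: "omega1 \<Rightarrow> omega1 \<Rightarrow> bool"
  where "less_omega1 a b \<longleftrightarrow> a \<le> b \<and> a \<noteq> b"

instance
proof
  note wo = Well_order_cardSuc_natLeq[unfolded well_order_on_def linear_order_on_def
      partial_order_on_def preorder_on_def]
  have anti: "antisym (cardSuc natLeq)" and tr: "trans (cardSuc natLeq)"
    and rf: "refl_on (Field (cardSuc natLeq)) (cardSuc natLeq)"
    and tot: "total_on (Field (cardSuc natLeq)) (cardSuc natLeq)"
    using wo by auto
  fix x y z :: omega1
  show A: "x \<le> y \<Longrightarrow> y \<le> x \<Longrightarrow> x = y" for x y :: omega1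
    using anti by transfer (auto dest: antisymD)
  show "x < y \<longleftrightarrow> x \<le> y \<and> \<not> y \<le> x"
    using A by (auto simp: less_omega1_def)
  show R: "x \<le> x" for x :: omega1
    using rf by transfer (auto dest: refl_onD)
  show "x \<le> y \<Longrightarrow> y \<le> z \<Longrightarrow> x \<le> z"
    using tr by transfer (auto dest: transD)
  show "x \<le> y \<or> y \<le> x"
    by (cases "x = y", simp add: R) (use tot in \<open>transfer; auto simp: total_on_def\<close>)
qed

end

instance omega1 :: wellorder
proof (rule wf_wellorderI)
  have "wf (cardSuc natLeq - Id)"
    using Well_order_cardSuc_natLeq unfolding well_order_on_def by blast
  then have "wf (inv_image (cardSuc natLeq - Id) Rep_omega1)"
    by (rule wf_inv_image)
  moreover have "{(x, y). x < y} \<subseteq> inv_image (cardSuc natLeq - Id) Rep_omega1"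
    by (auto simp: less_omega1_def less_eq_omega1.rep_eq inv_image_def Rep_omega1_inject)
  ultimately show "wf {(x::omega1, y). x < y}"
    by (rule wf_subset)
qed standard

lemma countable_below: "countable {..<a :: omega1}"
proof -
  let ?r = "cardSuc natLeq"
  have "|underS ?r (Rep_omega1 a)| <o ?r"
    by (rule card_of_underS[OF Card_order_cardSuc_natLeq]) (rule Rep_omega1)
  then have "|underS ?r (Rep_omega1 a)| \<le>o natLeq"
    by (simp add: cardSuc_ordLeq_ordLess[OF natLeq_Card_order card_of_Card_order])
  then have "countable (underS ?r (Rep_omega1 a))"
    by (simp add: countable_card_le_natLeq)
  moreover have "Rep_omega1 ` {..<a} \<subseteq> underS ?r (Rep_omega1 a)"
    by (auto simp: underS_def less_omega1_def less_eq_omega1.rep_eq Rep_omega1_inject)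
  ultimately have "countable (Rep_omega1 ` {..<a})"
    using countable_subset by blast
  then show ?thesis
    by (rule countable_image_inj_on) (simp add: inj_on_def Rep_omega1_inject)
qed

lemma uncountable_omega1: "uncountable (UNIV :: omega1 set)"
proof
  assume "countable (UNIV :: omega1 set)"
  then have "countable (range Rep_omega1)" by blast
  then show False
    using uncountable_Field_cardSuc type_definition.Rep_range[OF type_definition_omega1] by simp
qed

lemma ex_greater_omega1: "\<exists>b. (a :: omega1) < b"
proof (rule ccontr)
  assume "\<nexists>b. a < b"
  then have "UNIV = insert a {..<a}" by (auto simp: not_less order_le_less)
  then show False
    using uncountable_omega1 countable_below[of a] by (metis countable_insert)
qed

instantiation omega1 :: zero
begin
definition zero_omega1 :: omega1 where "0 = (LEAST a :: omega1. True)"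
instance ..
end

lemma zero_le_omega1: "(0 :: omega1) \<le> a"
  unfolding zero_omega1_def by (rule Least_le) simp

definition osucc :: "omega1 \<Rightarrow> omega1"
  where "osucc a = (LEAST b. a < b)"

definition is_limit :: "omega1 \<Rightarrow> bool"
  where "is_limit a \<longleftrightarrow> a \<noteq> 0 \<and> (\<forall>b. a \<noteq> osucc b)"

lemma less_osucc: "a < osucc a"
  unfolding osucc_def using ex_greater_omega1[of a] by (auto intro: LeastI_ex)

lemma osucc_le: "a < b \<Longrightarrow> osucc a \<le> b"
  unfolding osucc_def by (rule Least_le)

lemma osucc_mono: "a < b \<Longrightarrow> osucc a < osucc b"
  using osucc_le less_osucc by (metis order_le_less_trans)

lemma osucc_inject [simp]: "osucc a = osucc b \<longleftrightarrow> a = b"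
  using osucc_mono by (metis linorder_neqE less_irrefl)

lemma osucc_neq_zero [simp]: "osucc a \<noteq> 0" "0 \<noteq> osucc a"
  using less_osucc[of a] zero_le_omega1[of a] by (auto simp: not_less[symmetric])

lemma not_is_limit [simp]: "\<not> is_limit 0" "\<not> is_limit (osucc a)"
  by (auto simp: is_limit_def)

lemma omega1_cases:
  obtains "a = 0" | b where "a = osucc b" | "is_limit a"
  by (auto simp: is_limit_def)

unbundle no cardinal_syntax

subsection \<open>Countable ordinals together with \<open>\<infinity>\<close>\<close>

datatype omega1_inf = Fin omega1 | Infty

instantiation omega1_inf :: complete_linorder
begin

fun less_eq_omega1_inf :: "omega1_inf \<Rightarrow> omega1_inf \<Rightarrow> bool" where
  "Fin a \<le> Fin b \<longleftrightarrow> a \<le> b"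
| "x \<le> Infty \<longleftrightarrow> True"
| "Infty \<le> Fin b \<longleftrightarrow> False"

definition less_omega1_inf :: "omega1_inf \<Rightarrow> omega1_inf \<Rightarrow> bool"
  where "less_omega1_inf x y \<longleftrightarrow> x \<le> y \<and> \<not> y \<le> x"

definition bot_omega1_inf :: omega1_inf where "bot = Fin 0"
definition top_omega1_inf :: omega1_inf where "top = Infty"

definition inf_omega1_inf :: "omega1_inf \<Rightarrow> omega1_inf \<Rightarrow> omega1_inf"
  where "inf_omega1_inf x y = (if x \<le> y then x else y)"
definition sup_omega1_inf :: "omega1_inf \<Rightarrow> omega1_inf \<Rightarrow> omega1_inf"
  where "sup_omega1_inf x y = (if x \<le> y then y else x)"

definition Inf_omega1_inf :: "omega1_inf set \<Rightarrow> omega1_inf"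
  where "Inf_omega1_inf A =
    (if \<exists>a. Fin a \<in> A then Fin (LEAST a. Fin a \<in> A) else Infty)"
definition Sup_omega1_inf :: "omega1_inf set \<Rightarrow> omega1_inf"
  where "Sup_omega1_inf A = Inf {u. \<forall>x\<in>A. x \<le> u}"

instance
proof
  fix x y z :: omega1_inf and A :: "omega1_inf set"
  show "x < y \<longleftrightarrow> x \<le> y \<and> \<not> y \<le> x" by (rule less_omega1_inf_def)
  show "x \<le> x" by (cases x) auto
  show tr: "x \<le> y \<Longrightarrow> y \<le> z \<Longrightarrow> x \<le> z" for x y z :: omega1_inf
    by (cases x; cases y; cases z) auto
  show anti: "x \<le> y \<Longrightarrow> y \<le> x \<Longrightarrow> x = y" by (cases x; cases y) auto
  show lin: "x \<le> y \<or> y \<le> x" for x y :: omega1_inf by (cases x; cases y) auto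
  show "inf x y \<le> x" "inf x y \<le> y" "x \<le> y \<Longrightarrow> x \<le> z \<Longrightarrow> x \<le> inf y z"
    using lin[of x x] lin[of x y] lin[of y y] by (auto simp: inf_omega1_inf_def)
  show "x \<le> sup x y" "y \<le> sup x y" "y \<le> x \<Longrightarrow> z \<le> x \<Longrightarrow> sup y z \<le> x"
    using lin[of x x] lin[of x y] lin[of y y] by (auto simp: sup_omega1_inf_def)
  have lower: "Inf A \<le> x" if "x \<in> A" for x and A :: "omega1_inf set"
    using that by (cases x) (auto simp: Inf_omega1_inf_def intro: Least_le)
  have greatest: "z \<le> Inf A" if "\<And>x. x \<in> A \<Longrightarrow> z \<le> x" for z and A :: "omega1_inf set"
  proof (cases "\<exists>a. Fin a \<in> A")
    case True
    then have "Fin (LEAST a. Fin a \<in> A) \<in> A" by (rule LeastI_ex)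
    then show ?thesis using that True by (simp add: Inf_omega1_inf_def)
  qed (simp add: Inf_omega1_inf_def)
  show "x \<in> A \<Longrightarrow> Inf A \<le> x" by (rule lower)
  show "(\<And>x. x \<in> A \<Longrightarrow> z \<le> x) \<Longrightarrow> z \<le> Inf A" by (rule greatest)
  show "x \<in> A \<Longrightarrow> x \<le> Sup A"
    unfolding Sup_omega1_inf_def by (rule greatest) auto
  show "(\<And>x. x \<in> A \<Longrightarrow> x \<le> z) \<Longrightarrow> Sup A \<le> z"
    unfolding Sup_omega1_inf_def by (rule lower) auto
  show "Inf {} = (top :: omega1_inf)"
    by (simp add: Inf_omega1_inf_def top_omega1_inf_def)
  have "Fin 0 \<le> x" for x by (cases x) (auto simp: zero_le_omega1)
  then show "Sup {} = (bot :: omega1_inf)"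
    by (auto simp: Sup_omega1_inf_def Inf_omega1_inf_def bot_omega1_inf_def
        intro!: Least_equality zero_le_omega1)
qed

end

section \<open>Shortest path metrics\<close>

text \<open>
  \<open>step u v r\<close> means that one may pass from \<open>u\<close> to \<open>v\<close> at cost \<open>r\<close>.
\<close>

inductive walk :: "('p \<Rightarrow> 'p \<Rightarrow> real \<Rightarrow> bool) \<Rightarrow> 'p \<Rightarrow> 'p \<Rightarrow> real \<Rightarrow> bool"
  for step :: "'p \<Rightarrow> 'p \<Rightarrow> real \<Rightarrow> bool" where
  walk_refl: "walk step u u 0"
| walk_step: "step u v r \<Longrightarrow> walk step v w l \<Longrightarrow> walk step u w (r + l)"

definition path_dist :: "('p \<Rightarrow> 'p \<Rightarrow> real \<Rightarrow> bool) \<Rightarrow> 'p \<Rightarrow> 'p \<Rightarrow> real"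
  where "path_dist step u v = Inf {l. walk step u v l}"

section \<open>Points of the countably branching diamonds\<close>

text \<open>
  One type of names serves for all diamonds; which of these names are points of
  \<open>D\<^sub>\<alpha>\<close> is determined by \<open>diamond\<close> below.
  \<open>Mid i\<close> is \<open>x\<^sup>i\<close>; \<open>InCopy i \<sigma> p\<close> is the point \<open>p\<close>, different from top and bottom,
  of the copy \<open>D\<^sup>(\<^sup>i\<^sup>,\<^sup>\<sigma>\<^sup>)\<close> in a successor diamond; \<open>InPart n p\<close> is the point \<open>p\<close>, different
  from top and bottom, of the \<open>n\<close>-th summand in a limit diamond.  The maps \<open>copy_emb i \<sigma>\<close> and
  \<open>part_emb n\<close> are the canonical inclusions of the copies and of the summands; they incorporate
  the identifications of tops and bottoms.
\<close>

datatype sign = Plus | Minus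

datatype point = Top | Bot | Mid nat | InCopy nat sign point | InPart nat point

fun copy_emb :: "nat \<Rightarrow> sign \<Rightarrow> point \<Rightarrow> point" where
  "copy_emb i Plus Top = Top"
| "copy_emb i Plus Bot = Mid i"
| "copy_emb i Minus Top = Mid i"
| "copy_emb i Minus Bot = Bot"
| "copy_emb i \<sigma> p = InCopy i \<sigma> p"

fun part_emb :: "nat \<Rightarrow> point \<Rightarrow> point" where
  "part_emb n Top = Top"
| "part_emb n Bot = Bot"
| "part_emb n p = InPart n p"

definition original_D1 :: "point set"
  where "original_D1 = {Top, Bot} \<union> range Mid"

section \<open>The transfinite constructions\<close>

text \<open>
  For a limit ordinal \<open>\<alpha>\<close>, \<open>\<beta> \<alpha>\<close> is the fixed enumeration of the ordinals below \<open>\<alpha>\<close>.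
  Repetitions are not excluded; in particular all injective enumerations are covered.
\<close>

locale limit_enumeration =
  fixes \<beta> :: "omega1 \<Rightarrow> nat \<Rightarrow> omega1"
  assumes range_enumeration: "is_limit \<alpha> \<Longrightarrow> range (\<beta> \<alpha>) = {..<\<alpha>}"
begin

lemma enumeration_less: "is_limit \<alpha> \<Longrightarrow> \<beta> \<alpha> n < \<alpha>"
  using range_enumeration by blast

subsection \<open>Sprawling trees\<close>

function S :: "omega1 \<Rightarrow> (bit \<times> nat) list set" where
  "S 0 = {[]}"
| "S (osucc \<alpha>) = {[]} \<union> (\<Union>n. Cons (0, n) ` S \<alpha> \<union> Cons (1, n) ` S \<alpha>)"
| "is_limit \<alpha> \<Longrightarrow> S \<alpha> = {[]} \<union> (\<Union>n. Cons (0, n) ` S (\<beta> \<alpha> n))"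
  by (metis omega1_cases) auto
termination
  by (relation "{(x, y). x < y}") (auto simp: wf less_osucc enumeration_less)

definition successors :: "(bit \<times> nat) list set \<Rightarrow> (bit \<times> nat) list \<Rightarrow> (bit \<times> nat) set"
  where "successors T s = {a. s @ [a] \<in> T}"

definition type_B :: "omega1 \<Rightarrow> (bit \<times> nat) list \<Rightarrow> bool"
  where "type_B \<alpha> s \<longleftrightarrow> s \<in> S \<alpha> \<and> successors (S \<alpha>) s = {0, 1} \<times> UNIV"

definition type_C :: "omega1 \<Rightarrow> (bit \<times> nat) list \<Rightarrow> bool"
  where "type_C \<alpha> s \<longleftrightarrow> s \<in> S \<alpha> \<and> successors (S \<alpha>) s = {0} \<times> UNIV"

text \<open>The values of \<open>x\<close> outside \<open>S \<alpha>\<close> are irrelevant.\<close>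

definition sprawling_tree ::
    "real \<Rightarrow> omega1 \<Rightarrow> ((bit \<times> nat) list \<Rightarrow> 'a::real_normed_vector) \<Rightarrow> bool"
  where "sprawling_tree \<delta> \<alpha> x \<longleftrightarrow>
    (\<forall>s. type_B \<alpha> s \<longrightarrow>
       (\<forall>n. x s = (1/2) *\<^sub>R (x (s @ [(0, n)]) + x (s @ [(1, n)]))) \<and>
       (\<forall>n m. n \<noteq> m \<longrightarrow> norm (x (s @ [(0, n)]) - x (s @ [(0, m)])) \<ge> \<delta>)) \<and>
    (\<forall>s. type_C \<alpha> s \<longrightarrow> (\<forall>n. x s = x (s @ [(0, n)])))"

definition contains_sprawling_tree ::
    "'a::real_normed_vector set \<Rightarrow> real \<Rightarrow> omega1 \<Rightarrow> bool"
  where "contains_sprawling_tree B \<delta> \<alpha> \<longleftrightarrow>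
    (\<exists>x. x ` S \<alpha> \<subseteq> B \<and> sprawling_tree \<delta> \<alpha> x)"

text \<open>The infimum of the empty set is \<open>Infty\<close>.\<close>

definition ST_delta :: "'a::real_normed_vector itself \<Rightarrow> real \<Rightarrow> omega1_inf"
  where "ST_delta _ \<delta> =
    Inf (Fin ` {\<alpha>. \<not> contains_sprawling_tree (cball (0 :: 'a) 1) \<delta> \<alpha>})"

definition ST :: "'a::real_normed_vector itself \<Rightarrow> omega1_inf"
  where "ST X = (SUP \<delta>\<in>{0<..}. ST_delta X \<delta>)"

subsection \<open>Diamonds\<close>

function diamond :: "omega1 \<Rightarrow> point set" where
  "diamond 0 = {Top, Bot}"
| "diamond (osucc \<alpha>) = (\<Union>i \<sigma>. copy_emb i \<sigma> ` diamond \<alpha>)"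
| "is_limit \<alpha> \<Longrightarrow> diamond \<alpha> = (\<Union>n. part_emb n ` diamond (\<beta> \<alpha> n))"
  by (metis omega1_cases) auto
termination
  by (relation "{(x, y). x < y}") (auto simp: wf less_osucc enumeration_less)

text \<open>
  For \<open>\<alpha> = 0\<close> the successor clauses yield the complete bipartite graph \<open>D\<^sub>1\<close> with edges of
  length \<open>1/2\<close>, and the set of all two-element subsets of it as active pairs; so no separate
  clause for \<open>D\<^sub>1\<close> is needed (see \<open>diamond_1\<close>, \<open>ddist_1\<close> and \<open>active_pairs_1\<close>).
\<close>

function ddist :: "omega1 \<Rightarrow> point \<Rightarrow> point \<Rightarrow> real" where
  "ddist 0 = path_dist (\<lambda>u v r. {u, v} = {Top, Bot} \<and> r = 1)"
| "ddist (osucc \<alpha>) = path_dist (\<lambda>u v r. \<exists>i \<sigma>. \<exists>p\<in>diamond \<alpha>. \<exists>q\<in>diamond \<alpha>.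
     u = copy_emb i \<sigma> p \<and> v = copy_emb i \<sigma> q \<and> r = (1/2) * ddist \<alpha> p q)"
| "is_limit \<alpha> \<Longrightarrow> ddist \<alpha> = path_dist (\<lambda>u v r. \<exists>n. \<exists>p\<in>diamond (\<beta> \<alpha> n). \<exists>q\<in>diamond (\<beta> \<alpha> n).
     u = part_emb n p \<and> v = part_emb n q \<and> r = ddist (\<beta> \<alpha> n) p q)"
  by (metis omega1_cases) auto
termination
  by (relation "{(x, y). x < y}") (auto simp: wf less_osucc enumeration_less)

function active_pairs :: "omega1 \<Rightarrow> point set set" where
  "active_pairs 0 = {{Top, Bot}}"
| "active_pairs (osucc \<alpha>) =
     {P. P \<subseteq> original_D1 \<and> card P = 2} \<union> (\<Union>i \<sigma>. image (copy_emb i \<sigma>) ` active_pairs \<alpha>)"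
| "is_limit \<alpha> \<Longrightarrow> active_pairs \<alpha> = (\<Union>n. image (part_emb n) ` active_pairs (\<beta> \<alpha> n))"
  by (metis omega1_cases) auto
termination
  by (relation "{(x, y). x < y}") (auto simp: wf less_osucc enumeration_less)

text \<open>Active pairs are pairs of points of the diamond, so \<open>f\<close> is only used there.\<close>

definition sub_Lipschitz_embeds :: "omega1 \<Rightarrow> 'a::real_normed_vector itself \<Rightarrow> bool"
  where "sub_Lipschitz_embeds \<alpha> _ \<longleftrightarrow>
    (\<exists>A>0. \<exists>B>0. \<exists>f :: point \<Rightarrow> 'a. \<forall>u v. {u, v} \<in> active_pairs \<alpha> \<longrightarrow>
       A * ddist \<alpha> u v \<le> norm (f u - f v) \<and> norm (f u - f v) \<le> B * ddist \<alpha> u v)"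

end

section \<open>The Infinite Sprawling Tree Property and bi-Lipschitz embeddings\<close>

definition infinite_sprawling_tree_property :: "'a::real_normed_vector itself \<Rightarrow> bool"
  where "infinite_sprawling_tree_property _ \<longleftrightarrow>
    (\<exists>\<delta>>0. \<exists>f :: (bit \<times> nat) list \<Rightarrow> 'a. range f \<subseteq> cball 0 1 \<and>
       (\<forall>s. (\<forall>n. f s = (1/2) *\<^sub>R (f (s @ [(0, n)]) + f (s @ [(1, n)]))) \<and>
            (\<forall>n m. n \<noteq> m \<longrightarrow> norm (f (s @ [(0, n)]) - f (s @ [(0, m)])) \<ge> \<delta>)))"

definition bi_Lipschitz_embeds :: "'a::metric_space itself \<Rightarrow> 'b::metric_space itself \<Rightarrow> bool"
  where "bi_Lipschitz_embeds _ _ \<longleftrightarrow>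
    (\<exists>A>0. \<exists>B>0. \<exists>f :: 'a \<Rightarrow> 'b. \<forall>u v.
       A * dist u v \<le> dist (f u) (f v) \<and> dist (f u) (f v) \<le> B * dist u v)"

section \<open>Basic facts\<close>

lemma limit_enumeration_exists: "\<exists>\<beta>. limit_enumeration \<beta>"
proof
  show "limit_enumeration (\<lambda>a. from_nat_into {..<a})"
  proof
    fix a :: omega1
    assume "is_limit a"
    then have "0 < a"
      using zero_le_omega1[of a] by (auto simp: is_limit_def order_le_less)
    then show "range (from_nat_into {..<a}) = {..<a}"
      by (intro range_from_nat_into countable_below) auto
  qed
qed

lemma walk_append: "walk step u v l \<Longrightarrow> walk step v w m \<Longrightarrow> walk step u w (l + m)"
  by (induction rule: walk.induct) (auto simp: add.assoc intro: walk_step)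

lemma walk_single: "step u v r \<Longrightarrow> walk step u v r"
  using walk_step[OF _ walk_refl, of step u v r] by simp

lemma walk_trans_ex: "\<exists>l. walk step u v l \<Longrightarrow> \<exists>l. walk step v w l \<Longrightarrow> \<exists>l. walk step u w l"
  by (blast intro: walk_append)

lemma walk_potential:
  assumes "walk step u v l" and "\<And>u v r. step u v r \<Longrightarrow> \<bar>h u - h v\<bar> \<le> r"
  shows "\<bar>h u - h v\<bar> \<le> l"
  using assms by (induction rule: walk.induct) force+

lemma path_dist_le:
  assumes "walk step u v l" and "\<And>u v r. step u v r \<Longrightarrow> 0 \<le> r"
  shows "path_dist step u v \<le> l"
  unfolding path_dist_def
proof (rule cInf_lower)
  show "bdd_below {l. walk step u v l}"
    using walk_potential[of step u v _ "\<lambda>_. 0"] assms(2) by (intro bdd_belowI[of _ 0]) auto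
qed (use assms(1) in simp)

lemma path_dist_ge:
  assumes "walk step u v l" and "\<And>u v r. step u v r \<Longrightarrow> \<bar>h u - h v\<bar> \<le> r"
  shows "\<bar>h u - h v\<bar> \<le> path_dist step u v"
  unfolding path_dist_def using assms by (intro cInf_greatest) (auto intro: walk_potential)

lemma original_D1_eq: "original_D1 = (\<Union>i \<sigma>. copy_emb i \<sigma> ` {Top, Bot})"
proof
  show "original_D1 \<subseteq> (\<Union>i \<sigma>. copy_emb i \<sigma> ` {Top, Bot})"
  proof
    fix p assume "p \<in> original_D1"
    then consider "p = copy_emb 0 Plus Top" | "p = copy_emb 0 Minus Bot"
      | i where "p = copy_emb i Plus Bot"
      by (auto simp: original_D1_def)
    then show "p \<in> (\<Union>i \<sigma>. copy_emb i \<sigma> ` {Top, Bot})" by cases blast+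
  qed
  have "copy_emb i \<sigma> Top \<in> original_D1 \<and> copy_emb i \<sigma> Bot \<in> original_D1" for i \<sigma>
    by (cases \<sigma>) (simp_all add: original_D1_def)
  then show "(\<Union>i \<sigma>. copy_emb i \<sigma> ` {Top, Bot}) \<subseteq> original_D1" by auto
qed

fun height :: "point \<Rightarrow> real" where
  "height Top = 1"
| "height Bot = 0"
| "height (Mid i) = 1/2"
| "height (InCopy i Plus p) = (1 + height p) / 2"
| "height (InCopy i Minus p) = height p / 2"
| "height (InPart n p) = height p"

lemma height_copy_emb:
  "height (copy_emb i Plus p) = (1 + height p) / 2"
  "height (copy_emb i Minus p) = height p / 2"
  by (cases p; simp)+

lemma height_part_emb: "height (part_emb n p) = height p"
  by (cases p) auto

lemma height_copy_emb_diff: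
  "\<bar>height (copy_emb i \<sigma> p) - height (copy_emb i \<sigma> q)\<bar> = \<bar>height p - height q\<bar> / 2"
  by (cases \<sigma>) (auto simp: height_copy_emb field_simps abs_if)

context limit_enumeration
begin

lemma Top_Bot_in_diamond: "Top \<in> diamond \<alpha> \<and> Bot \<in> diamond \<alpha>"
proof (induction \<alpha> rule: diamond.induct)
  case (2 \<alpha>)
  then have "copy_emb 0 Plus Top \<in> diamond (osucc \<alpha>)" "copy_emb 0 Minus Bot \<in> diamond (osucc \<alpha>)"
    unfolding diamond.simps by blast+
  then show ?case by simp
next
  case (3 \<alpha>)
  then have "part_emb 0 Top \<in> diamond \<alpha>" "part_emb 0 Bot \<in> diamond \<alpha>"
    unfolding diamond.simps(3)[OF 3(1)] by blast+
  then show ?case by simp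
qed simp

lemma height_le_ddist:
  "p \<in> diamond \<alpha> \<Longrightarrow> q \<in> diamond \<alpha> \<Longrightarrow> \<bar>height p - height q\<bar> \<le> ddist \<alpha> p q"
proof (induction \<alpha> arbitrary: p q rule: diamond.induct)
  case 1
  let ?st = "\<lambda>u v r. {u, v} = {Top, Bot} \<and> r = (1::real)"
  have "\<exists>l. walk ?st p q l"
    using 1 walk_single[of ?st p q 1] walk_refl[of ?st p] by auto
  then obtain l where "walk ?st p q l" ..
  then show ?case unfolding ddist.simps
    by (rule path_dist_ge) (auto simp: doubleton_eq_iff)
next
  case (2 \<alpha>)
  let ?st = "\<lambda>u v r. \<exists>i \<sigma>. \<exists>p\<in>diamond \<alpha>. \<exists>q\<in>diamond \<alpha>.
     u = copy_emb i \<sigma> p \<and> v = copy_emb i \<sigma> q \<and> r = (1/2) * ddist \<alpha> p q"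
  have st: "\<exists>l. walk ?st (copy_emb i \<sigma> p) (copy_emb i \<sigma> q) l"
    if "p \<in> diamond \<alpha>" "q \<in> diamond \<alpha>" for i \<sigma> p q
    using walk_single[of ?st "copy_emb i \<sigma> p" "copy_emb i \<sigma> q"] that by blast
  have tr: "\<exists>l. walk ?st u w l" if "\<exists>l. walk ?st u v l" "\<exists>l. walk ?st v w l" for u v w
    using that by (rule walk_trans_ex)
  note TB = Top_Bot_in_diamond[of \<alpha>]
  have toTop: "\<exists>l. walk ?st u Top l" if u: "u \<in> diamond (osucc \<alpha>)" for u
  proof -
    obtain i \<sigma> p' where p': "p' \<in> diamond \<alpha>" "u = copy_emb i \<sigma> p'" using u by auto
    show ?thesis
    proof (cases \<sigma>)
      case Plus
      then show ?thesis using st[OF p'(1) conjunct1[OF TB], of i Plus] p' by simp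
    next
      case Minus
      then show ?thesis
        using tr[of u "Mid i" Top] st[OF p'(1) conjunct1[OF TB], of i Minus] p'
          st[OF conjunct2[OF TB] conjunct1[OF TB], of i Plus] by simp
    qed
  qed
  have fromTop: "\<exists>l. walk ?st Top u l" if u: "u \<in> diamond (osucc \<alpha>)" for u
  proof -
    obtain i \<sigma> p' where p': "p' \<in> diamond \<alpha>" "u = copy_emb i \<sigma> p'" using u by auto
    show ?thesis
    proof (cases \<sigma>)
      case Plus
      then show ?thesis using st[OF conjunct1[OF TB] p'(1), of i Plus] p' by simp
    next
      case Minus
      then show ?thesis
        using tr[of Top "Mid i" u] st[OF conjunct1[OF TB] p'(1), of i Minus] p'
          st[OF conjunct1[OF TB] conjunct2[OF TB], of i Plus] by simp
    qed
  qed
  obtain l where "walk ?st p q l"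
    using tr[OF toTop fromTop] 2 by blast
  moreover have "\<bar>height p - height q\<bar> \<le> ddist \<alpha> p q"
    if "p \<in> diamond \<alpha>" "q \<in> diamond \<alpha>" for p q
    using 2(1) that by simp
  ultimately show ?case unfolding ddist.simps
    by (intro path_dist_ge) (auto simp: height_copy_emb_diff)
next
  case (3 \<alpha>)
  let ?st = "\<lambda>u v r. \<exists>n. \<exists>p\<in>diamond (\<beta> \<alpha> n). \<exists>q\<in>diamond (\<beta> \<alpha> n).
     u = part_emb n p \<and> v = part_emb n q \<and> r = ddist (\<beta> \<alpha> n) p q"
  have st: "\<exists>l. walk ?st (part_emb n p) (part_emb n q) l"
    if "p \<in> diamond (\<beta> \<alpha> n)" "q \<in> diamond (\<beta> \<alpha> n)" for n p q
    using walk_single[of ?st "part_emb n p" "part_emb n q"] that by blast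
  obtain m p' n q' where pq: "p' \<in> diamond (\<beta> \<alpha> m)" "p = part_emb m p'"
      "q' \<in> diamond (\<beta> \<alpha> n)" "q = part_emb n q'"
    using 3 by auto
  have "\<exists>l. walk ?st p Top l" "\<exists>l. walk ?st Top q l"
    using st[of p' m Top] st[of Top n q'] Top_Bot_in_diamond[of "\<beta> \<alpha> m"]
      Top_Bot_in_diamond[of "\<beta> \<alpha> n"] pq by simp_all
  from walk_trans_ex[OF this] obtain l where "walk ?st p q l" ..
  moreover have "\<bar>height p - height q\<bar> \<le> ddist (\<beta> \<alpha> n) p q"
    if "p \<in> diamond (\<beta> \<alpha> n)" "q \<in> diamond (\<beta> \<alpha> n)" for n p q
    using 3(2) that by simp
  ultimately show ?case unfolding ddist.simps(3)[OF 3(1)]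
    by (intro path_dist_ge) (auto simp: height_part_emb)
qed

lemma ddist_nonneg: "p \<in> diamond \<alpha> \<Longrightarrow> q \<in> diamond \<alpha> \<Longrightarrow> 0 \<le> ddist \<alpha> p q"
  using height_le_ddist[of p \<alpha> q] by linarith

lemma ddist_Top_Bot: "ddist \<alpha> Top Bot = 1"
proof (rule antisym)
  show "1 \<le> ddist \<alpha> Top Bot"
    using height_le_ddist[of Top \<alpha> Bot] Top_Bot_in_diamond by simp
  show "ddist \<alpha> Top Bot \<le> 1"
  proof (induction \<alpha> rule: diamond.induct)
    case 1
    show ?case unfolding ddist.simps by (rule path_dist_le) (auto intro: walk_single)
  next
    case (2 \<alpha>)
    let ?st = "\<lambda>u v r. \<exists>i \<sigma>. \<exists>p\<in>diamond \<alpha>. \<exists>q\<in>diamond \<alpha>.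
       u = copy_emb i \<sigma> p \<and> v = copy_emb i \<sigma> q \<and> r = (1/2) * ddist \<alpha> p q"
    note TB = Top_Bot_in_diamond[of \<alpha>]
    let ?r = "(1/2) * ddist \<alpha> Top Bot"
    have "?st (copy_emb 0 Plus Top) (copy_emb 0 Plus Bot) ?r" using TB by blast
    moreover have "?st (copy_emb 0 Minus Top) (copy_emb 0 Minus Bot) ?r" using TB by blast
    ultimately have "walk ?st Top Bot (?r + ?r)"
      using walk_append[OF walk_single walk_single, of ?st Top "Mid 0" ?r Bot ?r]
      unfolding copy_emb.simps by blast
    then have "path_dist ?st Top Bot \<le> ?r + ?r"
      by (rule path_dist_le) (use ddist_nonneg in fastforce)
    then show ?case using 2 by simp
  next
    case (3 \<alpha>)
    let ?st = "\<lambda>u v r. \<exists>n. \<exists>p\<in>diamond (\<beta> \<alpha> n). \<exists>q\<in>diamond (\<beta> \<alpha> n).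
       u = part_emb n p \<and> v = part_emb n q \<and> r = ddist (\<beta> \<alpha> n) p q"
    have "?st (part_emb 0 Top) (part_emb 0 Bot) (ddist (\<beta> \<alpha> 0) Top Bot)"
      using Top_Bot_in_diamond by blast
    then have "walk ?st Top Bot (ddist (\<beta> \<alpha> 0) Top Bot)"
      unfolding part_emb.simps by (rule walk_single)
    then have "path_dist ?st Top Bot \<le> ddist (\<beta> \<alpha> 0) Top Bot"
      by (rule path_dist_le) (auto simp: ddist_nonneg)
    then show ?case using 3 by simp (use order_trans in blast)
  qed
qed

lemma diamond_1: "diamond (osucc 0) = original_D1"
  by (simp add: original_D1_eq)

lemma ddist_1:
  assumes "u \<in> original_D1" "v \<in> original_D1"
  defines "edge \<equiv> \<lambda>u v r. r = (1::real) \<and> (\<exists>i. {u, v} = {Top, Mid i} \<or> {u, v} = {Mid i, Bot})"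
  shows "ddist (osucc 0) u v = (1/2) * path_dist edge u v"
proof -
  let ?st = "\<lambda>u v r. \<exists>i \<sigma>. \<exists>p\<in>diamond 0. \<exists>q\<in>diamond 0.
       u = copy_emb i \<sigma> p \<and> v = copy_emb i \<sigma> q \<and> r = (1/2) * ddist 0 p q"
  let ?base = "\<lambda>u v r. {u, v} = {Top, Bot} \<and> r = (1::real)"
  have refl0: "ddist 0 p p = 0" if "p \<in> diamond 0" for p
    using height_le_ddist[OF that that] path_dist_le[OF walk_refl[of ?base p]] by simp
  have BT: "ddist 0 Bot Top = 1"
    using height_le_ddist[of Bot 0 Top] path_dist_le[OF walk_single[of ?base Bot Top 1]]
    by (auto simp: insert_commute)
  define st where "st = ?st"
  have stI: "st (copy_emb i \<sigma> p) (copy_emb i \<sigma> q) ((1/2) * ddist 0 p q)"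
    if "p \<in> diamond 0" "q \<in> diamond 0" for i \<sigma> p q
    unfolding st_def using that by blast
  have TB: "Top \<in> diamond 0" "Bot \<in> diamond 0" by simp_all
  have st_iff: "st u v r \<longleftrightarrow> edge u v (2 * r) \<or> (u = v \<and> u \<in> original_D1 \<and> r = 0)" for u v r
  proof
    assume "st u v r"
    then obtain i \<sigma> p q where *: "p \<in> diamond 0" "q \<in> diamond 0"
        "u = copy_emb i \<sigma> p" "v = copy_emb i \<sigma> q" "r = (1/2) * ddist 0 p q"
      unfolding st_def by (elim exE bexE conjE)
    show "edge u v (2 * r) \<or> (u = v \<and> u \<in> original_D1 \<and> r = 0)"
    proof (cases "p = q")
      case True
      have "u \<in> original_D1" using *(1,3) unfolding original_D1_eq diamond.simps by blast
      then show ?thesis using *(3-5) True refl0[OF *(1)] by simp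
    next
      case False
      then have pq: "(p = Top \<and> q = Bot) \<or> (p = Bot \<and> q = Top)" using *(1,2) by auto
      then have "ddist 0 p q = 1" using BT ddist_Top_Bot[of 0] by (elim disjE conjE) (simp_all only:)
      then have "2 * r = 1" using *(5) by simp
      then show ?thesis using *(3,4) pq
        by (cases \<sigma>) (auto simp: edge_def insert_commute)
    qed
  next
    note st4 = stI[OF TB, unfolded ddist_Top_Bot] stI[OF TB(2,1), unfolded BT]
    assume "edge u v (2 * r) \<or> (u = v \<and> u \<in> original_D1 \<and> r = 0)"
    then show "st u v r"
    proof
      assume e: "edge u v (2 * r)"
      then have r: "r = (1/2) * 1" by (simp add: edge_def)
      from e obtain i where "(u = Top \<and> v = Mid i) \<or> (u = Mid i \<and> v = Top)
        \<or> (u = Mid i \<and> v = Bot) \<or> (u = Bot \<and> v = Mid i)"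
        unfolding edge_def doubleton_eq_iff by blast
      then show "st u v r"
        using st4[of i Plus] st4[of i Minus] unfolding copy_emb.simps r
        by (elim disjE conjE) (simp_all only:)
    next
      assume a: "u = v \<and> u \<in> original_D1 \<and> r = 0"
      then obtain i \<sigma> p where p: "u = copy_emb i \<sigma> p" "p \<in> diamond 0"
        unfolding original_D1_eq diamond.simps by blast
      show "st u v r"
        using stI[OF p(2) p(2), of i \<sigma>] a p(1) unfolding refl0[OF p(2)] by simp
    qed
  qed
  have to_edge: "walk edge u v (2 * l)" if "walk st u v l" for u v l
    using that
  proof (induction rule: walk.induct)
    case (walk_refl u)
    then show ?case using walk.walk_refl[of edge u] by simp
  next
    case (walk_step u v r w l)
    then show ?case
      using walk.walk_step[of edge u v "2 * r" w "2 * l"] by (auto simp: st_iff algebra_simps)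
  qed
  have from_edge: "walk st u v ((1/2) * l)" if "walk edge u v l" for u v l
    using that
  proof (induction rule: walk.induct)
    case (walk_refl u)
    then show ?case using walk.walk_refl[of st u] by simp
  next
    case (walk_step u v r w l)
    have "st u v ((1/2) * r)" using walk_step(1) by (subst st_iff) simp
    from walk.walk_step[of st, OF this walk_step(3)] show ?case
      by (simp add: add_divide_distrib)
  qed
  have edge_1: "r = 1" if "edge u v r" for u v r
    using that unfolding edge_def by blast
  have st_nonneg: "0 \<le> r" if "st u v r" for u v r
    using that[unfolded st_iff] edge_1[of u v "2 * r"] by linarith
  have e: "edge Top (Mid i) 1" "edge (Mid i) Top 1" "edge (Mid i) Bot 1" "edge Bot (Mid i) 1" for i
    unfolding edge_def by blast+
  have TM: "\<exists>l. walk edge Top (Mid i) l" "\<exists>l. walk edge (Mid i) Top l"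
      "\<exists>l. walk edge (Mid i) Bot l" "\<exists>l. walk edge Bot (Mid i) l" for i
    using e[of i] by (blast intro: walk_single)+
  have toTop: "\<exists>l. walk edge x Top l" and fromTop: "\<exists>l. walk edge Top x l"
    if x: "x \<in> original_D1" for x
  proof -
    consider "x = Top" | "x = Bot" | i where "x = Mid i"
      using x unfolding original_D1_def by blast
    then show "\<exists>l. walk edge x Top l" "\<exists>l. walk edge Top x l"
      by (cases; use TM walk_refl[of edge Top] walk_trans_ex[OF TM(1) TM(3)]
          walk_trans_ex[OF TM(4) TM(2)] in blast)+
  qed
  obtain l where l: "walk edge u v l"
    using walk_trans_ex[OF toTop fromTop, OF assms(1,2)] ..
  show ?thesis unfolding ddist.simps(2) st_def[symmetric]
  proof (rule antisym)
    have "2 * path_dist st u v \<le> path_dist edge u v"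
      unfolding path_dist_def[of edge]
    proof (rule cInf_greatest)
      show "{l. walk edge u v l} \<noteq> {}" using l by blast
      fix m assume "m \<in> {l. walk edge u v l}"
      then have "path_dist st u v \<le> (1/2) * m"
        by (intro path_dist_le from_edge st_nonneg) auto
      then show "2 * path_dist st u v \<le> m" by simp
    qed
    then show "path_dist st u v \<le> (1/2) * path_dist edge u v" by simp
    show "(1/2) * path_dist edge u v \<le> path_dist st u v"
      unfolding path_dist_def[of st]
    proof (rule cInf_greatest)
      show "{l. walk st u v l} \<noteq> {}" using from_edge[OF l] by blast
      fix m assume "m \<in> {l. walk st u v l}"
      then have "path_dist edge u v \<le> 2 * m"
        by (intro path_dist_le to_edge) (auto dest: edge_1)
      then show "(1/2) * path_dist edge u v \<le> m" by simp
    qed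
  qed
qed

lemma active_pairs_1: "active_pairs (osucc 0) = {P. P \<subseteq> original_D1 \<and> card P = 2}"
proof -
  have "copy_emb i \<sigma> ` {Top, Bot} \<subseteq> original_D1 \<and> card (copy_emb i \<sigma> ` {Top, Bot}) = 2" for i \<sigma>
    by (cases \<sigma>) (auto simp: original_D1_def)
  then show ?thesis unfolding active_pairs.simps by blast
qed

lemma active_pairs_subset: "P \<in> active_pairs \<alpha> \<Longrightarrow> P \<subseteq> diamond \<alpha>"
proof (induction \<alpha> arbitrary: P rule: diamond.induct)
  case (2 \<alpha>)
  have "original_D1 \<subseteq> diamond (osucc \<alpha>)"
    using Top_Bot_in_diamond[of \<alpha>] unfolding original_D1_eq diamond.simps by blast
  moreover have "copy_emb i \<sigma> ` Q \<subseteq> diamond (osucc \<alpha>)" if "Q \<in> active_pairs \<alpha>" for i \<sigma> Q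
  proof -
    have "Q \<subseteq> diamond \<alpha>" using 2(1) that by simp
    then show ?thesis unfolding diamond.simps by blast
  qed
  ultimately show ?case
    using 2(2) unfolding active_pairs.simps
    by (elim UnE UN_E imageE CollectE conjE) (rule order_trans, assumption+, simp only:)
next
  case (3 \<alpha>)
  from 3(1,3) obtain n Q where Q: "Q \<in> active_pairs (\<beta> \<alpha> n)" "P = part_emb n ` Q" by auto
  then have "Q \<subseteq> diamond (\<beta> \<alpha> n)" using 3(2) by simp
  then show ?case using Q(2) 3(1) by auto
qed simp

end

end

theory Submission
  imports Defs
begin

text \<open>
  A sprawling tree is the family of slopes of a map on a diamond.  Let \<open>f\<close> be a map on the diamond
  \<open>D\<^sub>\<alpha>\<close>.  Every diamond used as a building block of \<open>D\<^sub>\<alpha>\<close> has a top and a bottom at distance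
  \<open>1/2^k\<close>, where \<open>k\<close> is the number of halvings that led to it; attach to it the slope
  \<open>2^k (f(top) - f(bottom))\<close>.  A midpoint \<open>x\<^sup>i\<close> of the block cuts it into an upper and a lower half,
  and the slope of the block is the average of the slopes of the two halves.  The upper halves for
  \<open>i\<close> and \<open>j\<close> have the same top, so their slopes differ by twice the rescaled vector
  \<open>f(x\<^sup>j) - f(x\<^sup>i)\<close>: the slopes are separated exactly if \<open>f\<close> separates the midpoints.  At a limit
  ordinal the summands share top and bottom, so the slope is repeated.  Hence the slopes of a
  sub-Lipschitz map form a bounded sprawling tree (\<open>sprawling_tree_from_sub_Lipschitz\<close>).

  Conversely, \<open>f\<close> is recovered from its slopes by adding them up from the bottom
  (\<open>diamond_map\<close>).  Boundedness of the tree is the upper estimate for \<open>f\<close>, separation is the lower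
  estimate on pairs of midpoints, and the lower estimate on the remaining active pairs says that
  the slopes stay away from \<open>0\<close>.  Nothing in the tree guarantees this, but translating the whole
  tree by one vector of norm 2 respects all defining relations of a tree and moves the
  unit ball away from \<open>0\<close> (\<open>less_ST_iff_sub_Lipschitz_embeds\<close>).  Since trees restrict to smaller
  ordinals, \<open>ST(X) > \<alpha>\<close> just means that for some \<open>\<delta> > 0\<close> the unit ball contains a
  \<open>\<delta>\<close>-\<open>\<alpha>\<close>-sprawling tree (\<open>less_ST_iff\<close>), and the first claim follows.

  Composition with a bi-Lipschitz map keeps a map sub-Lipschitz, which turns the first claim into
  the monotonicity of \<open>ST\<close> (\<open>ST_mono_bi_Lipschitz\<close>).  For infinite trees the same two steps,
  adding up slopes in \<open>Y\<close> and taking slopes after the bi-Lipschitz map, can be done in one go,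
  node by node (\<open>slope_tree\<close>), so the Infinite Sprawling Tree Property passes from \<open>Y\<close> to \<open>X\<close>.

  All this takes for granted that distances inside a block are not shortened by the rest of the
  diamond; this is \<open>ddist_copy_emb\<close> and \<open>ddist_part_emb\<close>.
\<close>

section \<open>Midpoints and shortest paths\<close>

text \<open>
  Separation in a tree is demanded only of the children with first entry 0.  The midpoint of such a
  child and its partner with first entry 1 is the node itself, so the partners are equally far apart.
\<close>

lemma midpoint_partner_diff:
  fixes a b :: "'a::real_vector"
  assumes "c = (1/2) *\<^sub>R (a + b)" "c = (1/2) *\<^sub>R (a' + b')"
  shows "b - b' = a' - a"
proof -
  have "a + b = a' + b'" using assms by simp
  then have "b = a' + b' - a" by (metis add_diff_cancel_left')
  then show ?thesis by simp
qed

lemma walk_reverse: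
  assumes "walk step u v l" and sym: "\<And>u v r. step u v r \<Longrightarrow> step v u r"
  shows "walk step v u l"
  using assms(1)
proof (induction rule: walk.induct)
  case (walk_step u v r w l)
  then show ?case
    using walk_append[OF walk_step(3) walk_single[of step, OF sym[OF walk_step(1)]]]
    by (simp add: add.commute)
qed (rule walk_refl)

lemma path_dist_sym:
  assumes "\<And>u v r. step u v r \<Longrightarrow> step v u r"
  shows "path_dist step u v = path_dist step v u"
proof -
  have "walk step u v = walk step v u"
    using walk_reverse[of step, OF _ assms] by blast
  then show ?thesis unfolding path_dist_def by simp
qed

lemma path_dist_triangle:
  assumes "\<exists>l. walk step u v l" "\<exists>l. walk step v w l"
    and nonneg: "\<And>u v r. step u v r \<Longrightarrow> 0 \<le> r"
  shows "path_dist step u w \<le> path_dist step u v + path_dist step v w"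
proof -
  have "path_dist step u w - m \<le> path_dist step u v" if m: "walk step v w m" for m
    unfolding path_dist_def[of step u v]
  proof (rule cInf_greatest)
    fix l assume "l \<in> {l. walk step u v l}"
    then have "walk step u w (l + m)" using walk_append m by fast
    then have "path_dist step u w \<le> l + m" using nonneg by (rule path_dist_le)
    then show "path_dist step u w - m \<le> l" by simp
  qed (use assms(1) in simp)
  then have "path_dist step u w - path_dist step u v \<le> m" if "walk step v w m" for m
    using that by (simp add: algebra_simps)
  then have "path_dist step u w - path_dist step u v \<le> path_dist step v w"
    unfolding path_dist_def[of step v w]
    by (intro cInf_greatest) (use assms(2) in auto)
  then show ?thesis by simp
qed

lemma walks_through_hub:
  assumes "\<exists>l. walk step u c l" "\<exists>l. walk step v c l"
    and "\<And>u v r. step u v r \<Longrightarrow> step v u r"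
  shows "\<exists>l. walk step u v l"
  using assms(1,2) walk_reverse[of step v c, OF _ assms(3)] walk_trans_ex[of step u c v] by blast

section \<open>The metric of the diamonds\<close>

lemma inj_copy_emb: "inj (copy_emb i \<sigma>)"
proof (rule injI)
  fix p q assume "copy_emb i \<sigma> p = copy_emb i \<sigma> q"
  then show "p = q" by (cases \<sigma>; cases p; cases q) auto
qed

lemma inj_part_emb: "inj (part_emb n)"
proof (rule injI)
  fix p q assume "part_emb n p = part_emb n q"
  then show "p = q" by (cases p; cases q) auto
qed

lemma pair_eq_image_injE:
  assumes "{u, v} = h ` Q" "inj h"
  obtains u' v' where "u = h u'" "v = h v'" "Q = {u', v'}"
proof -
  obtain u' v' where uv: "u' \<in> Q" "v' \<in> Q" "u = h u'" "v = h v'"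
    using assms(1) by blast
  have "Q = {u', v'}"
  proof -
    have "h ` Q = h ` {u', v'}"
      by (simp only: image_insert image_empty uv(3,4)[symmetric] assms(1))
    then show ?thesis by (simp only: inj_image_eq_iff[OF assms(2)])
  qed
  with uv that show thesis by blast
qed

text \<open>
  The distance between top and bottom of a copy equals the difference of their heights.  So a
  1-Lipschitz function on the copy extends to a 1-Lipschitz function on the whole diamond: outside
  the copy, interpolate linearly in the height between the values at top and bottom of the copy, and
  stay constant above and below.  Applied to the distance from a point of the copy, the extension
  shows that no detour outside the copy is a shortcut.  The function \<open>h\<close> is given in the
  coordinates and the scale of the small diamond, hence the factor \<open>1/2\<close>.
\<close>

definition extend_from_copy :: "nat \<Rightarrow> sign \<Rightarrow> (point \<Rightarrow> real) \<Rightarrow> point \<Rightarrow> real" where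
  "extend_from_copy i \<sigma> h u =
    (let t = (case \<sigma> of Plus \<Rightarrow> max 0 (2 * height u - 1) | Minus \<Rightarrow> min 1 (2 * height u));
         outside = (h Bot + (h Top - h Bot) * t) / 2
     in case u of InCopy j \<tau> p \<Rightarrow> if j = i \<and> \<tau> = \<sigma> then h p / 2 else outside
        | _ \<Rightarrow> outside)"

lemma extend_from_copy_inside: "extend_from_copy i \<sigma> h (copy_emb i \<sigma> p) = h p / 2"
  by (cases \<sigma>; cases p) (simp_all add: extend_from_copy_def)

lemma extend_from_copy_outside:
  assumes "(j, \<tau>) \<noteq> (i, \<sigma>)" and "\<bar>h Top - h Bot\<bar> \<le> 1"
  shows "\<bar>extend_from_copy i \<sigma> h (copy_emb j \<tau> p) - extend_from_copy i \<sigma> h (copy_emb j \<tau> q)\<bar>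
    \<le> \<bar>height p - height q\<bar> / 2"
proof -
  define t where "t u = (case \<sigma> of Plus \<Rightarrow> max 0 (2 * height u - 1) | Minus \<Rightarrow> min 1 (2 * height u))"
    for u
  have val: "extend_from_copy i \<sigma> h (copy_emb j \<tau> p) =
      (h Bot + (h Top - h Bot) * t (copy_emb j \<tau> p)) / 2" for p
    using assms(1) by (cases \<tau>; cases p) (auto simp: extend_from_copy_def t_def Let_def)
  have t: "\<bar>t u - t v\<bar> \<le> 2 * \<bar>height u - height v\<bar>" for u v
    by (cases \<sigma>) (auto simp: t_def max_def min_def abs_if)
  have "extend_from_copy i \<sigma> h (copy_emb j \<tau> p) - extend_from_copy i \<sigma> h (copy_emb j \<tau> q)
      = (h Top - h Bot) * ((t (copy_emb j \<tau> p) - t (copy_emb j \<tau> q)) / 2)"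
    unfolding val by (simp add: field_simps)
  then have "\<bar>extend_from_copy i \<sigma> h (copy_emb j \<tau> p) - extend_from_copy i \<sigma> h (copy_emb j \<tau> q)\<bar>
      = \<bar>h Top - h Bot\<bar> * (\<bar>t (copy_emb j \<tau> p) - t (copy_emb j \<tau> q)\<bar> / 2)"
    by (simp only: abs_mult abs_divide abs_numeral)
  also have "\<dots> \<le> 1 * (\<bar>t (copy_emb j \<tau> p) - t (copy_emb j \<tau> q)\<bar> / 2)"
    by (rule mult_right_mono[OF assms(2)]) simp
  also have "\<dots> \<le> \<bar>height p - height q\<bar> / 2"
    using t[of "copy_emb j \<tau> p" "copy_emb j \<tau> q"] by (simp add: height_copy_emb_diff)
  finally show ?thesis .
qed

text \<open>
  The summands of a limit diamond share top and bottom with the whole, so here the interpolation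
  covers all heights and there is no change of scale.
\<close>

definition extend_from_part :: "nat \<Rightarrow> (point \<Rightarrow> real) \<Rightarrow> point \<Rightarrow> real" where
  "extend_from_part n h u =
    (let outside = h Bot + (h Top - h Bot) * height u
     in case u of InPart m p \<Rightarrow> if m = n then h p else outside | _ \<Rightarrow> outside)"

lemma extend_from_part_inside: "extend_from_part n h (part_emb n p) = h p"
  by (cases p) (simp_all add: extend_from_part_def)

lemma extend_from_part_outside:
  assumes "m \<noteq> n" and "\<bar>h Top - h Bot\<bar> \<le> 1"
  shows "\<bar>extend_from_part n h (part_emb m p) - extend_from_part n h (part_emb m q)\<bar>
    \<le> \<bar>height p - height q\<bar>"
proof -
  have val: "extend_from_part n h (part_emb m p) = h Bot + (h Top - h Bot) * height p" for p
    using assms(1) by (cases p) (auto simp: extend_from_part_def Let_def)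
  have "extend_from_part n h (part_emb m p) - extend_from_part n h (part_emb m q)
      = (h Top - h Bot) * (height p - height q)"
    unfolding val by (simp add: algebra_simps)
  then show ?thesis using mult_right_mono[OF assms(2), of "\<bar>height p - height q\<bar>"]
    by (simp add: abs_mult)
qed

text \<open>
  The distance in height to the nearer of top and bottom, multiplied by the weight \<open>w k\<close> on the two
  copies with index \<open>k\<close>.  Copies with different indices meet only at top and bottom, where this
  distance vanishes, so the weights can be chosen independently.
\<close>

definition signed_bump :: "(nat \<Rightarrow> real) \<Rightarrow> point \<Rightarrow> real" where
  "signed_bump w u =
    (case u of Mid k \<Rightarrow> w k | InCopy k _ _ \<Rightarrow> w k | _ \<Rightarrow> 0) * (1/2 - \<bar>height u - 1/2\<bar>)"

lemma signed_bump_copy_emb: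
  "signed_bump w (copy_emb k \<sigma> p) = w k * (1/2 - \<bar>height (copy_emb k \<sigma> p) - 1/2\<bar>)"
  by (cases \<sigma>; cases p) (simp_all add: signed_bump_def)

context limit_enumeration
begin

declare ddist.simps [simp del]

definition copy_step :: "omega1 \<Rightarrow> point \<Rightarrow> point \<Rightarrow> real \<Rightarrow> bool" where
  "copy_step \<alpha> u v r \<longleftrightarrow> (\<exists>i \<sigma>. \<exists>p\<in>diamond \<alpha>. \<exists>q\<in>diamond \<alpha>.
     u = copy_emb i \<sigma> p \<and> v = copy_emb i \<sigma> q \<and> r = (1/2) * ddist \<alpha> p q)"

definition part_step :: "omega1 \<Rightarrow> point \<Rightarrow> point \<Rightarrow> real \<Rightarrow> bool" where
  "part_step \<alpha> u v r \<longleftrightarrow> (\<exists>n. \<exists>p\<in>diamond (\<beta> \<alpha> n). \<exists>q\<in>diamond (\<beta> \<alpha> n).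
     u = part_emb n p \<and> v = part_emb n q \<and> r = ddist (\<beta> \<alpha> n) p q)"

lemma ddist_osucc: "ddist (osucc \<alpha>) = path_dist (copy_step \<alpha>)"
  unfolding ddist.simps copy_step_def[abs_def] ..

lemma ddist_limit: "is_limit \<alpha> \<Longrightarrow> ddist \<alpha> = path_dist (part_step \<alpha>)"
  unfolding ddist.simps part_step_def[abs_def] ..

lemma copy_stepI:
  "p \<in> diamond \<alpha> \<Longrightarrow> q \<in> diamond \<alpha> \<Longrightarrow>
    copy_step \<alpha> (copy_emb i \<sigma> p) (copy_emb i \<sigma> q) ((1/2) * ddist \<alpha> p q)"
  unfolding copy_step_def by blast

lemma part_stepI:
  "p \<in> diamond (\<beta> \<alpha> n) \<Longrightarrow> q \<in> diamond (\<beta> \<alpha> n) \<Longrightarrow>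
    part_step \<alpha> (part_emb n p) (part_emb n q) (ddist (\<beta> \<alpha> n) p q)"
  unfolding part_step_def by blast

lemma copy_stepE:
  assumes "copy_step \<alpha> u v r"
  obtains i \<sigma> p q where "p \<in> diamond \<alpha>" "q \<in> diamond \<alpha>"
    "u = copy_emb i \<sigma> p" "v = copy_emb i \<sigma> q" "r = (1/2) * ddist \<alpha> p q"
  using assms unfolding copy_step_def by blast

lemma part_stepE:
  assumes "part_step \<alpha> u v r"
  obtains n p q where "p \<in> diamond (\<beta> \<alpha> n)" "q \<in> diamond (\<beta> \<alpha> n)"
    "u = part_emb n p" "v = part_emb n q" "r = ddist (\<beta> \<alpha> n) p q"
  using assms unfolding part_step_def by blast

lemma copy_step_nonneg: "copy_step \<alpha> u v r \<Longrightarrow> 0 \<le> r"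
  by (auto elim!: copy_stepE simp: ddist_nonneg)

lemma part_step_nonneg: "part_step \<alpha> u v r \<Longrightarrow> 0 \<le> r"
  by (auto elim!: part_stepE simp: ddist_nonneg)

lemma ddist_sym: "ddist \<alpha> p q = ddist \<alpha> q p"
proof (induction \<alpha> arbitrary: p q rule: diamond.induct)
  case 1
  show ?case unfolding ddist.simps by (rule path_dist_sym) (auto simp: insert_commute)
next
  case (2 \<alpha>)
  show ?case unfolding ddist_osucc
    proof (rule path_dist_sym)
    fix u v r assume "copy_step \<alpha> u v r"
    then obtain i \<sigma> p q where *: "p \<in> diamond \<alpha>" "q \<in> diamond \<alpha>"
      "u = copy_emb i \<sigma> p" "v = copy_emb i \<sigma> q" "r = (1/2) * ddist \<alpha> p q"
      by (rule copy_stepE)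
    show "copy_step \<alpha> v u r"
      unfolding *(3-5) by (subst 2[of i \<sigma> p q]) (rule UNIV_I copy_stepI[OF *(2,1)])+
  qed
next
  case (3 \<alpha>)
  show ?case unfolding ddist_limit[OF 3(1)]
    proof (rule path_dist_sym)
    fix u v r assume "part_step \<alpha> u v r"
    then obtain n p q where *: "p \<in> diamond (\<beta> \<alpha> n)" "q \<in> diamond (\<beta> \<alpha> n)"
      "u = part_emb n p" "v = part_emb n q" "r = ddist (\<beta> \<alpha> n) p q"
      by (rule part_stepE)
    show "part_step \<alpha> v u r"
      unfolding *(3-5) by (subst 3(2)[of n p q]) (rule UNIV_I part_stepI[OF *(2,1)])+
  qed
qed

lemma copy_step_sym: "copy_step \<alpha> u v r \<Longrightarrow> copy_step \<alpha> v u r"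
  by (erule copy_stepE) (metis ddist_sym copy_stepI)

lemma part_step_sym: "part_step \<alpha> u v r \<Longrightarrow> part_step \<alpha> v u r"
  by (erule part_stepE) (metis ddist_sym part_stepI)

lemma diamond_osucc_connected:
  assumes "u \<in> diamond (osucc \<alpha>)" "v \<in> diamond (osucc \<alpha>)"
  shows "\<exists>l. walk (copy_step \<alpha>) u v l"
proof (rule walks_through_hub[where c = Top])
  note TB = Top_Bot_in_diamond[of \<alpha>]
  have plus: "\<exists>l. walk (copy_step \<alpha>) (copy_emb i Plus p) Top l" if "p \<in> diamond \<alpha>" for i p
    using walk_single[of "copy_step \<alpha>", OF copy_stepI[OF that conjunct1[OF TB], of i Plus]] by auto
  have minus: "\<exists>l. walk (copy_step \<alpha>) (copy_emb i Minus p) Top l" if "p \<in> diamond \<alpha>" for i p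
    using walk_trans_ex[of "copy_step \<alpha>" _ "Mid i" Top] plus[OF conjunct2[OF TB], of i]
      walk_single[of "copy_step \<alpha>", OF copy_stepI[OF that conjunct1[OF TB], of i Minus]] by auto
  have "\<exists>l. walk (copy_step \<alpha>) u Top l" if "u \<in> diamond (osucc \<alpha>)" for u
  proof -
    obtain i \<sigma> p where "p \<in> diamond \<alpha>" "u = copy_emb i \<sigma> p" using \<open>u \<in> _\<close> by auto
    then show ?thesis using plus minus by (cases \<sigma>) auto
  qed
  with assms show "\<exists>l. walk (copy_step \<alpha>) u Top l" "\<exists>l. walk (copy_step \<alpha>) v Top l" by auto
qed (rule copy_step_sym)

lemma diamond_limit_connected:
  assumes "is_limit \<alpha>" "u \<in> diamond \<alpha>" "v \<in> diamond \<alpha>"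
  shows "\<exists>l. walk (part_step \<alpha>) u v l"
proof (rule walks_through_hub[where c = Top])
  have "\<exists>l. walk (part_step \<alpha>) u Top l" if u: "u \<in> diamond \<alpha>" for u
  proof -
    obtain n p where "p \<in> diamond (\<beta> \<alpha> n)" "u = part_emb n p" using u assms(1) by auto
    then show ?thesis
      using walk_single[of "part_step \<alpha>", OF part_stepI[of p \<alpha> n Top]] Top_Bot_in_diamond[of "\<beta> \<alpha> n"]
      by auto
  qed
  with assms show "\<exists>l. walk (part_step \<alpha>) u Top l" "\<exists>l. walk (part_step \<alpha>) v Top l" by auto
qed (rule part_step_sym)

lemma ddist_triangle:
  assumes "p \<in> diamond \<alpha>" "q \<in> diamond \<alpha>" "r \<in> diamond \<alpha>"
  shows "ddist \<alpha> p r \<le> ddist \<alpha> p q + ddist \<alpha> q r"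
proof (cases rule: omega1_cases[of \<alpha>])
  case 1
  let ?st = "\<lambda>u v r. {u, v} = {Top, Bot} \<and> r = (1::real)"
  have w: "\<exists>l. walk ?st u v l" if "u \<in> {Top, Bot}" "v \<in> {Top, Bot}" for u v
    using that walk_single[of ?st u v 1] walk_refl[of ?st u] by auto
  show ?thesis using assms w unfolding 1 ddist.simps diamond.simps
    by (intro path_dist_triangle) auto
next
  case (2 \<gamma>)
  show ?thesis using assms unfolding 2 ddist_osucc
    by (intro path_dist_triangle diamond_osucc_connected) (auto intro: copy_step_nonneg)
next
  case 3
  show ?thesis using assms unfolding ddist_limit[OF 3]
    by (intro path_dist_triangle diamond_limit_connected 3) (auto intro: part_step_nonneg)
qed

lemma ddist_refl:
  assumes "p \<in> diamond \<alpha>"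
  shows "ddist \<alpha> p p = 0"
proof (rule antisym[OF _ ddist_nonneg[OF assms assms]])
  show "ddist \<alpha> p p \<le> 0"
  proof (cases rule: omega1_cases[of \<alpha>])
    case 1
    show ?thesis unfolding 1 ddist.simps by (rule path_dist_le[OF walk_refl]) auto
  next
    case (2 \<gamma>)
    show ?thesis unfolding 2 ddist_osucc by (rule path_dist_le[OF walk_refl copy_step_nonneg])
  next
    case 3
    show ?thesis unfolding ddist_limit[OF 3] by (rule path_dist_le[OF walk_refl part_step_nonneg])
  qed
qed

lemma ddist_lipschitz:
  assumes "p \<in> diamond \<alpha>" "u \<in> diamond \<alpha>" "v \<in> diamond \<alpha>"
  shows "\<bar>ddist \<alpha> p u - ddist \<alpha> p v\<bar> \<le> ddist \<alpha> u v"
  using ddist_triangle[OF assms(1,2,3)] ddist_triangle[OF assms(1,3,2)] ddist_sym[of \<alpha> u v]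
  by (simp add: abs_le_iff)

text \<open>
  A path that leaves the copy and returns does so through top and bottom of the copy; the extension
  of the distance from \<open>p\<close> is 1-Lipschitz along such a detour as well, so it bounds the length of
  every path from below.
\<close>

lemma ddist_copy_emb:
  assumes "p \<in> diamond \<alpha>" "q \<in> diamond \<alpha>"
  shows "ddist (osucc \<alpha>) (copy_emb i \<sigma> p) (copy_emb i \<sigma> q) = ddist \<alpha> p q / 2"
proof (rule antisym)
  have w: "walk (copy_step \<alpha>) (copy_emb i \<sigma> p) (copy_emb i \<sigma> q) ((1/2) * ddist \<alpha> p q)"
    by (rule walk_single[of "copy_step \<alpha>", OF copy_stepI[OF assms]])
  show "ddist (osucc \<alpha>) (copy_emb i \<sigma> p) (copy_emb i \<sigma> q) \<le> ddist \<alpha> p q / 2"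
    using path_dist_le[of "copy_step \<alpha>", OF w copy_step_nonneg] by (simp add: ddist_osucc)
  let ?h = "ddist \<alpha> p"
  let ?g = "extend_from_copy i \<sigma> ?h"
  have tb: "\<bar>?h Top - ?h Bot\<bar> \<le> 1"
    using ddist_lipschitz[OF assms(1), of Top Bot] Top_Bot_in_diamond[of \<alpha>] ddist_Top_Bot[of \<alpha>]
    by simp
  have lip: "\<bar>?g u - ?g v\<bar> \<le> r" if "copy_step \<alpha> u v r" for u v r
    using that
  proof (rule copy_stepE)
    fix j \<tau> p' q' assume *: "p' \<in> diamond \<alpha>" "q' \<in> diamond \<alpha>"
      "u = copy_emb j \<tau> p'" "v = copy_emb j \<tau> q'" "r = (1/2) * ddist \<alpha> p' q'"
    show ?thesis
    proof (cases "(j, \<tau>) = (i, \<sigma>)")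
      case True
      then have "\<bar>?g u - ?g v\<bar> = \<bar>?h p' - ?h q'\<bar> / 2"
        unfolding * by (simp add: extend_from_copy_inside flip: diff_divide_distrib)
      then show ?thesis
        using ddist_lipschitz[OF assms(1) *(1,2)] by (simp add: *(5))
    next
      case False
      show ?thesis
        using extend_from_copy_outside[OF False tb, of p' q'] height_le_ddist[OF *(1,2)]
        by (simp add: *(3-5))
    qed
  qed
  have "\<bar>?g (copy_emb i \<sigma> p) - ?g (copy_emb i \<sigma> q)\<bar>
      \<le> ddist (osucc \<alpha>) (copy_emb i \<sigma> p) (copy_emb i \<sigma> q)"
    unfolding ddist_osucc by (rule path_dist_ge[where h = ?g, OF w lip])
  then show "ddist \<alpha> p q / 2 \<le> ddist (osucc \<alpha>) (copy_emb i \<sigma> p) (copy_emb i \<sigma> q)"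
    unfolding extend_from_copy_inside using ddist_refl[OF assms(1)] ddist_nonneg[OF assms] by simp
qed

lemma ddist_part_emb:
  assumes lim: "is_limit \<alpha>" and "p \<in> diamond (\<beta> \<alpha> n)" "q \<in> diamond (\<beta> \<alpha> n)"
  shows "ddist \<alpha> (part_emb n p) (part_emb n q) = ddist (\<beta> \<alpha> n) p q"
proof (rule antisym)
  note pq = assms(2,3)
  have w: "walk (part_step \<alpha>) (part_emb n p) (part_emb n q) (ddist (\<beta> \<alpha> n) p q)"
    by (rule walk_single[of "part_step \<alpha>", OF part_stepI[OF pq]])
  show "ddist \<alpha> (part_emb n p) (part_emb n q) \<le> ddist (\<beta> \<alpha> n) p q"
    unfolding ddist_limit[OF lim] by (rule path_dist_le[OF w part_step_nonneg])
  let ?h = "ddist (\<beta> \<alpha> n) p"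
  let ?g = "extend_from_part n ?h"
  have tb: "\<bar>?h Top - ?h Bot\<bar> \<le> 1"
    using ddist_lipschitz[OF pq(1), of Top Bot] Top_Bot_in_diamond[of "\<beta> \<alpha> n"]
      ddist_Top_Bot[of "\<beta> \<alpha> n"] by simp
  have lip: "\<bar>?g u - ?g v\<bar> \<le> r" if "part_step \<alpha> u v r" for u v r
    using that
  proof (rule part_stepE)
    fix m p' q' assume *: "p' \<in> diamond (\<beta> \<alpha> m)" "q' \<in> diamond (\<beta> \<alpha> m)"
      "u = part_emb m p'" "v = part_emb m q'" "r = ddist (\<beta> \<alpha> m) p' q'"
    show ?thesis
    proof (cases "m = n")
      case True
      then show ?thesis using ddist_lipschitz[OF pq(1), of p' q'] *
        by (simp add: extend_from_part_inside)
    next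
      case False
      show ?thesis
        using extend_from_part_outside[OF False tb, of p' q'] height_le_ddist[OF *(1,2)]
        by (simp add: *(3-5))
    qed
  qed
  have "\<bar>?g (part_emb n p) - ?g (part_emb n q)\<bar> \<le> ddist \<alpha> (part_emb n p) (part_emb n q)"
    unfolding ddist_limit[OF lim] by (rule path_dist_ge[where h = ?g, OF w lip])
  then show "ddist (\<beta> \<alpha> n) p q \<le> ddist \<alpha> (part_emb n p) (part_emb n q)"
    unfolding extend_from_part_inside using ddist_refl[OF pq(1)] ddist_nonneg[OF pq] by simp
qed

lemma ddist_Top_Mid: "ddist (osucc \<alpha>) Top (Mid i) = 1/2"
  using ddist_copy_emb[of Top \<alpha> Bot i Plus] Top_Bot_in_diamond[of \<alpha>] by (simp add: ddist_Top_Bot)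

lemma Mid_in_diamond: "Mid i \<in> diamond (osucc \<alpha>)"
proof -
  have "copy_emb i Plus Bot \<in> diamond (osucc \<alpha>)"
    using Top_Bot_in_diamond[of \<alpha>] unfolding diamond.simps by blast
  then show ?thesis by simp
qed

lemma ddist_Mid_Mid:
  assumes "i \<noteq> j"
  shows "ddist (osucc \<alpha>) (Mid i) (Mid j) = 1"
proof (rule antisym)
  show "ddist (osucc \<alpha>) (Mid i) (Mid j) \<le> 1"
    using ddist_triangle[of "Mid i" "osucc \<alpha>" Top "Mid j"] Mid_in_diamond[of _ \<alpha>]
      Top_Bot_in_diamond[of "osucc \<alpha>"] ddist_sym[of _ "Mid i" Top]
    by (simp add: ddist_Top_Mid)
  \<comment> \<open>The function rises from \<open>-1/2\<close> at \<open>Mid j\<close> to \<open>0\<close> at top and bottom and to \<open>1/2\<close> at \<open>Mid i\<close>.\<close>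
  define w :: "nat \<Rightarrow> real" where "w k = (if k = i then 1 else if k = j then -1 else 0)" for k
  have "\<bar>signed_bump w u - signed_bump w v\<bar> \<le> r" if "copy_step \<alpha> u v r" for u v r
    using that
  proof (rule copy_stepE)
    fix k \<tau> p q assume *: "p \<in> diamond \<alpha>" "q \<in> diamond \<alpha>"
      "u = copy_emb k \<tau> p" "v = copy_emb k \<tau> q" "r = (1/2) * ddist \<alpha> p q"
    have "\<bar>signed_bump w u - signed_bump w v\<bar> \<le> \<bar>height u - height v\<bar>"
      unfolding * signed_bump_copy_emb w_def by auto
    also have "\<dots> \<le> r"
      using height_le_ddist[OF *(1,2)] by (simp add: *(3-5) height_copy_emb_diff)
    finally show ?thesis .
  qed
  moreover obtain l where "walk (copy_step \<alpha>) (Mid i) (Mid j) l"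
    using diamond_osucc_connected[OF Mid_in_diamond Mid_in_diamond] by blast
  ultimately have "\<bar>signed_bump w (Mid i) - signed_bump w (Mid j)\<bar> \<le> ddist (osucc \<alpha>) (Mid i) (Mid j)"
    unfolding ddist_osucc by (intro path_dist_ge) auto
  then show "1 \<le> ddist (osucc \<alpha>) (Mid i) (Mid j)"
    using assms by (simp add: signed_bump_def w_def)
qed

section \<open>Sub-Lipschitz maps on diamonds\<close>

definition sub_Lipschitz :: "omega1 \<Rightarrow> real \<Rightarrow> real \<Rightarrow> (point \<Rightarrow> 'a::real_normed_vector) \<Rightarrow> bool" where
  "sub_Lipschitz \<alpha> A B f \<longleftrightarrow> (\<forall>u v. {u, v} \<in> active_pairs \<alpha> \<longrightarrow>
     A * ddist \<alpha> u v \<le> norm (f u - f v) \<and> norm (f u - f v) \<le> B * ddist \<alpha> u v)"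

lemma sub_LipschitzI:
  assumes "\<And>u v. {u, v} \<in> active_pairs \<alpha> \<Longrightarrow>
    A * ddist \<alpha> u v \<le> norm (f u - f v) \<and> norm (f u - f v) \<le> B * ddist \<alpha> u v"
  shows "sub_Lipschitz \<alpha> A B f"
  using assms unfolding sub_Lipschitz_def by blast

lemma sub_LipschitzD:
  assumes "sub_Lipschitz \<alpha> A B f" "{u, v} \<in> active_pairs \<alpha>"
  shows "A * ddist \<alpha> u v \<le> norm (f u - f v)" "norm (f u - f v) \<le> B * ddist \<alpha> u v"
  using assms unfolding sub_Lipschitz_def by blast+

lemma Top_Bot_active: "{Top, Bot} \<in> active_pairs \<alpha>"
proof (induction \<alpha> rule: diamond.induct)
  case (2 \<alpha>)
  show ?case by (simp add: original_D1_def)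
next
  case (3 \<alpha>)
  have "part_emb 0 ` {Top, Bot} \<in> active_pairs \<alpha>"
    unfolding active_pairs.simps(3)[OF 3(1)] using 3(2)[of 0] by blast
  then show ?case by simp
qed simp

lemma sub_Lipschitz_Top_Bot:
  assumes "sub_Lipschitz \<alpha> A B f"
  shows "A \<le> norm (f Top - f Bot)" "norm (f Top - f Bot) \<le> B"
  using sub_LipschitzD[OF assms Top_Bot_active] by (simp_all add: ddist_Top_Bot)

lemma sub_Lipschitz_zero:
  "sub_Lipschitz 0 A B f \<longleftrightarrow> A \<le> norm (f Top - f Bot) \<and> norm (f Top - f Bot) \<le> B"
  by (auto simp: sub_Lipschitz_def doubleton_eq_iff ddist_Top_Bot ddist_sym[of 0 Bot Top]
      norm_minus_commute)

lemma active_pair_in_diamond: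
  "{u, v} \<in> active_pairs \<alpha> \<Longrightarrow> u \<in> diamond \<alpha> \<and> v \<in> diamond \<alpha>"
  using active_pairs_subset[of "{u, v}" \<alpha>] by simp

text \<open>
  An edge \<open>{Top, Mid i}\<close> or \<open>{Mid i, Bot}\<close> is the pair of top and bottom of a copy.  So the pairs of
  the original \<open>D\<^sub>1\<close> that the copies do not account for are \<open>{Top, Bot}\<close> and the pairs of midpoints,
  all at distance 1.  On a copy, doubling \<open>f\<close> compensates for the halved metric, so that the two
  constants never change in the recursion.
\<close>

lemma sub_Lipschitz_osucc:
  "sub_Lipschitz (osucc \<alpha>) A B f \<longleftrightarrow>
    A \<le> norm (f Top - f Bot) \<and> norm (f Top - f Bot) \<le> B \<and>
    (\<forall>i j. i \<noteq> j \<longrightarrow> A \<le> norm (f (Mid i) - f (Mid j)) \<and> norm (f (Mid i) - f (Mid j)) \<le> B) \<and>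
    (\<forall>i \<sigma>. sub_Lipschitz \<alpha> A B (\<lambda>p. 2 *\<^sub>R f (copy_emb i \<sigma> p)))"
    (is "?L \<longleftrightarrow> ?T1 \<and> ?T2 \<and> ?M \<and> ?C")
proof
  have scale: "norm (2 *\<^sub>R f u - 2 *\<^sub>R f v) = 2 * norm (f u - f v)" for u v
    by (metis scaleR_right_diff_distrib norm_scaleR abs_numeral)
  {
    assume L: ?L
    have ?M
    proof (intro allI impI)
      fix i j :: nat assume "i \<noteq> j"
      then have "{Mid i, Mid j} \<in> active_pairs (osucc \<alpha>)" by (simp add: original_D1_def)
      from sub_LipschitzD[OF L this] \<open>i \<noteq> j\<close>
      show "A \<le> norm (f (Mid i) - f (Mid j)) \<and> norm (f (Mid i) - f (Mid j)) \<le> B"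
        by (simp add: ddist_Mid_Mid)
    qed
    moreover have ?C
    proof (intro allI sub_LipschitzI)
      fix i \<sigma> p q assume pq: "{p, q} \<in> active_pairs \<alpha>"
      then have "copy_emb i \<sigma> ` {p, q} \<in> active_pairs (osucc \<alpha>)"
        unfolding active_pairs.simps by blast
      then show "A * ddist \<alpha> p q \<le> norm (2 *\<^sub>R f (copy_emb i \<sigma> p) - 2 *\<^sub>R f (copy_emb i \<sigma> q)) \<and>
        norm (2 *\<^sub>R f (copy_emb i \<sigma> p) - 2 *\<^sub>R f (copy_emb i \<sigma> q)) \<le> B * ddist \<alpha> p q"
        using sub_LipschitzD[OF L, of "copy_emb i \<sigma> p" "copy_emb i \<sigma> q"]
          active_pair_in_diamond[OF pq] by (simp add: scale ddist_copy_emb)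
    qed
    ultimately show "?T1 \<and> ?T2 \<and> ?M \<and> ?C" using sub_Lipschitz_Top_Bot[OF L] by blast
  }
  assume R: "?T1 \<and> ?T2 \<and> ?M \<and> ?C"
  define P where "P u v \<longleftrightarrow> A * ddist (osucc \<alpha>) u v \<le> norm (f u - f v) \<and>
    norm (f u - f v) \<le> B * ddist (osucc \<alpha>) u v" for u v
  have sym: "P u v \<longleftrightarrow> P v u" for u v
    unfolding P_def by (simp add: ddist_sym[of _ u v] norm_minus_commute)
  have copy: "P (copy_emb i \<sigma> p) (copy_emb i \<sigma> q)" if pq: "{p, q} \<in> active_pairs \<alpha>" for i \<sigma> p q
    using sub_LipschitzD[OF _ pq, of A B "\<lambda>p. 2 *\<^sub>R f (copy_emb i \<sigma> p)"] R
      active_pair_in_diamond[OF pq] by (simp add: P_def scale ddist_copy_emb)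
  have edges: "P Top (Mid i)" "P (Mid i) Bot" for i
    using copy[OF Top_Bot_active, of i Plus] copy[OF Top_Bot_active, of i Minus] by simp_all
  have diag: "P Top Bot" using R by (simp add: P_def ddist_Top_Bot)
  have mids: "P (Mid i) (Mid j)" if "i \<noteq> j" for i j
    using R that by (simp add: P_def ddist_Mid_Mid)
  show ?L
  proof (rule sub_LipschitzI, fold P_def)
    fix u v assume "{u, v} \<in> active_pairs (osucc \<alpha>)"
    then consider "{u, v} \<subseteq> original_D1" "card {u, v} = 2"
      | i \<sigma> Q where "Q \<in> active_pairs \<alpha>" "{u, v} = copy_emb i \<sigma> ` Q"
      unfolding active_pairs.simps by blast
    then show "P u v"
    proof cases
      case 1
      then have "u \<noteq> v" by (cases "u = v") auto
      with 1(1) show ?thesis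
        using edges diag mids edges[THEN sym[THEN iffD1]] diag[THEN sym[THEN iffD1]]
        by (auto simp: original_D1_def)
    next
      case 2
      from pair_eq_image_injE[OF 2(2) inj_copy_emb] 2(1) copy show ?thesis by metis
    qed
  qed
qed

lemma sub_Lipschitz_limit:
  assumes "is_limit \<alpha>"
  shows "sub_Lipschitz \<alpha> A B f \<longleftrightarrow> (\<forall>n. sub_Lipschitz (\<beta> \<alpha> n) A B (\<lambda>p. f (part_emb n p)))"
proof
  assume L: "sub_Lipschitz \<alpha> A B f"
  show "\<forall>n. sub_Lipschitz (\<beta> \<alpha> n) A B (\<lambda>p. f (part_emb n p))"
  proof (intro allI sub_LipschitzI)
    fix n p q assume pq: "{p, q} \<in> active_pairs (\<beta> \<alpha> n)"
    then have "part_emb n ` {p, q} \<in> active_pairs \<alpha>"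
      unfolding active_pairs.simps(3)[OF assms] by blast
    then show "A * ddist (\<beta> \<alpha> n) p q \<le> norm (f (part_emb n p) - f (part_emb n q)) \<and>
        norm (f (part_emb n p) - f (part_emb n q)) \<le> B * ddist (\<beta> \<alpha> n) p q"
      using sub_LipschitzD[OF L, of "part_emb n p" "part_emb n q"]
        active_pair_in_diamond[OF pq] by (simp add: ddist_part_emb[OF assms])
  qed
next
  assume R: "\<forall>n. sub_Lipschitz (\<beta> \<alpha> n) A B (\<lambda>p. f (part_emb n p))"
  show "sub_Lipschitz \<alpha> A B f"
  proof (rule sub_LipschitzI)
    fix u v assume "{u, v} \<in> active_pairs \<alpha>"
    then obtain n Q where Q: "Q \<in> active_pairs (\<beta> \<alpha> n)" "{u, v} = part_emb n ` Q"
      unfolding active_pairs.simps(3)[OF assms] by blast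
    from Q(2) inj_part_emb obtain p q where pq: "u = part_emb n p" "v = part_emb n q" "Q = {p, q}"
      by (rule pair_eq_image_injE)
    have "{p, q} \<in> active_pairs (\<beta> \<alpha> n)" using Q(1) pq(3) by simp
    then show "A * ddist \<alpha> u v \<le> norm (f u - f v) \<and> norm (f u - f v) \<le> B * ddist \<alpha> u v"
      using sub_LipschitzD[OF R[rule_format, of n]] active_pair_in_diamond[of p q "\<beta> \<alpha> n"]
      by (simp add: pq(1,2) ddist_part_emb[OF assms])
  qed
qed

lemma sub_Lipschitz_translate:
  "sub_Lipschitz \<alpha> A B (\<lambda>p. v + f p) \<longleftrightarrow> sub_Lipschitz \<alpha> A B f"
  unfolding sub_Lipschitz_def by simp

lemma sub_Lipschitz_embeds_iff:
  "sub_Lipschitz_embeds \<alpha> TYPE('a::real_normed_vector) \<longleftrightarrow>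
    (\<exists>A>0. \<exists>B>0. \<exists>f :: point \<Rightarrow> 'a. sub_Lipschitz \<alpha> A B f)"
  unfolding sub_Lipschitz_embeds_def sub_Lipschitz_def ..

lemma sub_Lipschitz_embeds_bi_Lipschitz:
  assumes "bi_Lipschitz_embeds TYPE('b::real_normed_vector) TYPE('a::real_normed_vector)"
    and "sub_Lipschitz_embeds \<alpha> TYPE('b)"
  shows "sub_Lipschitz_embeds \<alpha> TYPE('a)"
proof -
  obtain A B and g :: "'b \<Rightarrow> 'a" where g: "0 < A" "0 < B"
    "\<And>u v. A * norm (u - v) \<le> norm (g u - g v)" "\<And>u v. norm (g u - g v) \<le> B * norm (u - v)"
    using assms(1) unfolding bi_Lipschitz_embeds_def dist_norm by blast
  obtain A' B' and f :: "point \<Rightarrow> 'b" where f: "0 < A'" "0 < B'" "sub_Lipschitz \<alpha> A' B' f"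
    using assms(2) unfolding sub_Lipschitz_embeds_iff by blast
  have "sub_Lipschitz \<alpha> (A * A') (B * B') (\<lambda>p. g (f p))"
  proof (rule sub_LipschitzI)
    fix u v assume "{u, v} \<in> active_pairs \<alpha>"
    note D = sub_LipschitzD[OF f(3) this]
    have "A * (A' * ddist \<alpha> u v) \<le> A * norm (f u - f v)" using D(1) g(1) by simp
    moreover have "B * norm (f u - f v) \<le> B * (B' * ddist \<alpha> u v)" using D(2) g(2) by simp
    ultimately show "A * A' * ddist \<alpha> u v \<le> norm (g (f u) - g (f v)) \<and>
        norm (g (f u) - g (f v)) \<le> B * B' * ddist \<alpha> u v"
      using g(3,4)[of "f u" "f v"] by (simp add: mult.assoc)
  qed
  then show ?thesis
    unfolding sub_Lipschitz_embeds_iff using g(1,2) f(1,2) by (meson mult_pos_pos)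
qed

section \<open>Sprawling trees\<close>

lemma Nil_in_S: "[] \<in> S \<alpha>"
  by (cases rule: omega1_cases[of \<alpha>]) auto

lemma Cons_in_S_osucc: "(b, n) # s \<in> S (osucc \<alpha>) \<longleftrightarrow> s \<in> S \<alpha>"
  by (cases b) auto

lemma Cons_in_S_limit: "is_limit \<alpha> \<Longrightarrow> (b, n) # s \<in> S \<alpha> \<longleftrightarrow> b = 0 \<and> s \<in> S (\<beta> \<alpha> n)"
  by auto

lemma sprawling_tree_zero: "sprawling_tree \<delta> 0 x"
  by (auto simp: sprawling_tree_def type_B_def type_C_def successors_def)

lemma all_node_iff: "(\<forall>s. P s) \<longleftrightarrow> P [] \<and> (\<forall>b n s. P ((b, n) # s))"
  by (metis list.exhaust surj_pair)

text \<open>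
  The subtree above a child of the root is again a sprawling tree, because the type of a node depends
  only on the nodes above it.  The same holds at limit ordinals, where the root has type (C).
\<close>

lemma sprawling_tree_osucc:
  "sprawling_tree \<delta> (osucc \<alpha>) x \<longleftrightarrow>
    (\<forall>n. x [] = (1/2) *\<^sub>R (x [(0, n)] + x [(1, n)])) \<and>
    (\<forall>n m. n \<noteq> m \<longrightarrow> \<delta> \<le> norm (x [(0, n)] - x [(0, m)])) \<and>
    (\<forall>b n. sprawling_tree \<delta> \<alpha> (\<lambda>s. x ((b, n) # s)))"
proof -
  have "successors (S (osucc \<alpha>)) [] = {0, 1} \<times> UNIV"
    unfolding successors_def using Cons_in_S_osucc[of _ _ "[]" \<alpha>] Nil_in_S[of \<alpha>]
    by (auto simp del: S.simps)
  then have root: "type_B (osucc \<alpha>) []" "\<not> type_C (osucc \<alpha>) []"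
    by (auto simp: type_B_def type_C_def Nil_in_S simp del: S.simps)
  have succ: "successors (S (osucc \<alpha>)) ((b, n) # s) = successors (S \<alpha>) s" for b n s
    by (simp add: successors_def Cons_in_S_osucc del: S.simps)
  have types: "type_B (osucc \<alpha>) ((b, n) # s) \<longleftrightarrow> type_B \<alpha> s"
    "type_C (osucc \<alpha>) ((b, n) # s) \<longleftrightarrow> type_C \<alpha> s" for b n s
    by (simp_all add: type_B_def type_C_def succ Cons_in_S_osucc del: S.simps)
  show ?thesis
    unfolding sprawling_tree_def all_node_iff[of "\<lambda>s. type_B (osucc \<alpha>) s \<longrightarrow> _ s"]
      all_node_iff[of "\<lambda>s. type_C (osucc \<alpha>) s \<longrightarrow> _ s"]
    by (simp add: root types all_conj_distrib conj_ac)
qed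

lemma sprawling_tree_limit:
  assumes "is_limit \<alpha>"
  shows "sprawling_tree \<delta> \<alpha> x \<longleftrightarrow>
    (\<forall>n. x [] = x [(0, n)]) \<and> (\<forall>n. sprawling_tree \<delta> (\<beta> \<alpha> n) (\<lambda>s. x ((0, n) # s)))"
proof -
  note mem = Cons_in_S_limit[OF assms]
  have "successors (S \<alpha>) [] = {0} \<times> UNIV"
    by (auto simp: successors_def mem Nil_in_S simp del: S.simps)
  then have root: "\<not> type_B \<alpha> []" "type_C \<alpha> []"
    by (auto simp: type_B_def type_C_def Nil_in_S simp del: S.simps)
  have succ: "successors (S \<alpha>) ((0, n) # s) = successors (S (\<beta> \<alpha> n)) s" for n s
    by (simp add: successors_def mem del: S.simps)
  have types: "type_B \<alpha> ((b, n) # s) \<longleftrightarrow> b = 0 \<and> type_B (\<beta> \<alpha> n) s"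
    "type_C \<alpha> ((b, n) # s) \<longleftrightarrow> b = 0 \<and> type_C (\<beta> \<alpha> n) s" for b n s
    using succ by (auto simp: type_B_def type_C_def mem simp del: S.simps)
  show ?thesis
    unfolding sprawling_tree_def all_node_iff[of "\<lambda>s. type_B \<alpha> s \<longrightarrow> _ s"]
      all_node_iff[of "\<lambda>s. type_C \<alpha> s \<longrightarrow> _ s"]
    by (simp add: root types) blast
qed

lemma sprawling_tree_affine:
  assumes "sprawling_tree \<delta> \<alpha> x" "0 \<le> c"
  shows "sprawling_tree (c * \<delta>) \<alpha> (\<lambda>s. v + c *\<^sub>R x s)"
proof -
  have mid: "v + c *\<^sub>R ((1/2) *\<^sub>R (a + b)) = (1/2) *\<^sub>R ((v + c *\<^sub>R a) + (v + c *\<^sub>R b))" for a b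
    by (simp add: algebra_simps flip: scaleR_add_left)
  have "c * \<delta> \<le> norm ((v + c *\<^sub>R a) - (v + c *\<^sub>R b))" if "\<delta> \<le> norm (a - b)" for a b
  proof -
    have "(v + c *\<^sub>R a) - (v + c *\<^sub>R b) = c *\<^sub>R (a - b)" by (simp add: algebra_simps)
    then show ?thesis using that assms(2) by (simp add: mult_left_mono)
  qed
  note sep = this
  show ?thesis
    unfolding sprawling_tree_def
  proof (intro conjI allI impI)
    fix s n assume "type_B \<alpha> s"
    then have "x s = (1/2) *\<^sub>R (x (s @ [(0, n)]) + x (s @ [(1, n)]))"
      using assms(1) unfolding sprawling_tree_def by blast
    then show "v + c *\<^sub>R x s =
        (1/2) *\<^sub>R (v + c *\<^sub>R x (s @ [(0, n)]) + (v + c *\<^sub>R x (s @ [(1, n)])))"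
      by (simp only: mid)
  next
    fix s and n m :: nat assume "type_B \<alpha> s" "n \<noteq> m"
    then show "c * \<delta> \<le> norm (v + c *\<^sub>R x (s @ [(0, n)]) - (v + c *\<^sub>R x (s @ [(0, m)])))"
      using assms(1) by (intro sep) (simp add: sprawling_tree_def)
  next
    fix s n assume "type_C \<alpha> s"
    then have "x s = x (s @ [(0, n)])"
      using assms(1) unfolding sprawling_tree_def by blast
    then show "v + c *\<^sub>R x s = v + c *\<^sub>R x (s @ [(0, n)])" by simp
  qed
qed

section \<open>Trees and embedded diamonds\<close>

lemma omega1_induct [case_names zero osucc limit]:
  assumes "P 0" "\<And>\<alpha>. P \<alpha> \<Longrightarrow> P (osucc \<alpha>)"
    "\<And>\<alpha>. is_limit \<alpha> \<Longrightarrow> (\<And>n. P (\<beta> \<alpha> n)) \<Longrightarrow> P \<alpha>"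
  shows "P \<alpha>"
proof (induction \<alpha> rule: less_induct)
  case (less \<alpha>)
  show ?case
    by (cases rule: omega1_cases[of \<alpha>])
      (use assms less less_osucc enumeration_less in blast)+
qed

text \<open>
  The slopes of \<open>f\<close>: the root carries the slope of the whole diamond, and the subtrees above its
  children are the slope trees of the copies or summands.  The factor 2 in the separation is the
  doubling of \<open>f\<close> on the copies.
\<close>

lemma sprawling_tree_from_sub_Lipschitz:
  assumes "sub_Lipschitz \<alpha> A B f"
  shows "\<exists>x. x [] = f Top - f Bot \<and> (\<forall>s\<in>S \<alpha>. norm (x s) \<le> B) \<and> sprawling_tree (2 * A) \<alpha> x"
  using assms
proof (induction \<alpha> arbitrary: f rule: omega1_induct)
  case zero
  then show ?case
    by (intro exI[of _ "\<lambda>_. f Top - f Bot"]) (simp add: sprawling_tree_zero sub_Lipschitz_zero)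
next
  case (osucc \<alpha>)
  have "\<exists>x. x [] = 2 *\<^sub>R f (copy_emb i \<sigma> Top) - 2 *\<^sub>R f (copy_emb i \<sigma> Bot) \<and>
      (\<forall>s\<in>S \<alpha>. norm (x s) \<le> B) \<and> sprawling_tree (2 * A) \<alpha> x" for i \<sigma>
    using osucc.IH[of "\<lambda>p. 2 *\<^sub>R f (copy_emb i \<sigma> p)"] osucc.prems
    unfolding sub_Lipschitz_osucc by blast
  then obtain X where X: "X i \<sigma> [] = 2 *\<^sub>R f (copy_emb i \<sigma> Top) - 2 *\<^sub>R f (copy_emb i \<sigma> Bot)"
    "\<And>s. s \<in> S \<alpha> \<Longrightarrow> norm (X i \<sigma> s) \<le> B" "sprawling_tree (2 * A) \<alpha> (X i \<sigma>)" for i \<sigma>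
    by metis
  define x where "x s = (case s of [] \<Rightarrow> f Top - f Bot
    | (b, n) # t \<Rightarrow> X n (if b = 0 then Plus else Minus) t)" for s
  have x: "x [] = f Top - f Bot" "x ((b, n) # t) = X n (if b = 0 then Plus else Minus) t" for b n t
    by (simp_all add: x_def)
  have roots: "x [(0, n)] = 2 *\<^sub>R f Top - 2 *\<^sub>R f (Mid n)"
    "x [(1, n)] = 2 *\<^sub>R f (Mid n) - 2 *\<^sub>R f Bot" for n
    by (simp_all add: x X(1))
  have "sprawling_tree (2 * A) (osucc \<alpha>) x"
    unfolding sprawling_tree_osucc
  proof (intro conjI allI impI)
    show "x [] = (1/2) *\<^sub>R (x [(0, n)] + x [(1, n)])" for n
      unfolding roots x(1) by (simp add: algebra_simps)
    fix n m :: nat assume "n \<noteq> m"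
    then have "A \<le> norm (f (Mid m) - f (Mid n))"
      using osucc.prems by (simp add: sub_Lipschitz_osucc)
    moreover have "x [(0, n)] - x [(0, m)] = 2 *\<^sub>R (f (Mid m) - f (Mid n))"
      unfolding roots by (simp add: algebra_simps)
    ultimately show "2 * A \<le> norm (x [(0, n)] - x [(0, m)])" by simp
  next
    show "sprawling_tree (2 * A) \<alpha> (\<lambda>s. x ((b, n) # s))" for b n
      by (simp add: x X(3))
  qed
  moreover have "norm (x s) \<le> B" if "s \<in> S (osucc \<alpha>)" for s
  proof (cases s)
    case Nil
    then show ?thesis using sub_Lipschitz_Top_Bot[OF osucc.prems] x by simp
  next
    case (Cons a t)
    then obtain b n where "s = (b, n) # t" by (cases a) auto
    then show ?thesis using that X(2) by (simp only: x Cons_in_S_osucc)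
  qed
  ultimately show ?case using x(1) by blast
next
  case (limit \<alpha>)
  have "\<exists>x. x [] = f Top - f Bot \<and>
      (\<forall>s\<in>S (\<beta> \<alpha> n). norm (x s) \<le> B) \<and> sprawling_tree (2 * A) (\<beta> \<alpha> n) x" for n
    using limit.IH[of n "\<lambda>p. f (part_emb n p)"] limit.prems limit.hyps
    by (simp add: sub_Lipschitz_limit)
  then obtain X where X: "X n [] = f Top - f Bot"
    "\<And>s. s \<in> S (\<beta> \<alpha> n) \<Longrightarrow> norm (X n s) \<le> B" "sprawling_tree (2 * A) (\<beta> \<alpha> n) (X n)" for n
    by metis
  define x where "x s = (case s of [] \<Rightarrow> f Top - f Bot | (b, n) # t \<Rightarrow> X n t)" for s :: "(bit \<times> nat) list"
  have x: "x [] = f Top - f Bot" "x ((b, n) # t) = X n t" for b n t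
    by (simp_all add: x_def)
  have "sprawling_tree (2 * A) \<alpha> x"
    unfolding sprawling_tree_limit[OF limit.hyps] by (simp add: x X)
  moreover have "norm (x s) \<le> B" if "s \<in> S \<alpha>" for s
  proof (cases s)
    case Nil
    then show ?thesis using sub_Lipschitz_Top_Bot[OF limit.prems] x by simp
  next
    case (Cons a t)
    then obtain b n where "s = (b, n) # t" by (cases a) auto
    then show ?thesis using that X(2) by (simp only: x Cons_in_S_limit[OF limit.hyps])
  qed
  ultimately show ?case using x(1) by blast
qed

text \<open>
  The map with slopes \<open>x\<close> that vanishes at the bottom.  On an upper copy the summand
  \<open>x [(1, i)]\<close> is twice the increment from \<open>Bot\<close> to the bottom \<open>Mid i\<close> of the copy.  The clause for
  \<open>Top\<close> fits together with the clauses for the copies and summands by the defining relation of a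
  tree at the root: the midpoint equation for type (B), the equality with the children for type (C).
\<close>

fun diamond_map :: "((bit \<times> nat) list \<Rightarrow> 'a::real_normed_vector) \<Rightarrow> point \<Rightarrow> 'a" where
  "diamond_map x Top = x []"
| "diamond_map x Bot = 0"
| "diamond_map x (Mid i) = (1/2) *\<^sub>R x [(1, i)]"
| "diamond_map x (InCopy i Plus p) =
    (1/2) *\<^sub>R (x [(1, i)] + diamond_map (\<lambda>s. x ((0, i) # s)) p)"
| "diamond_map x (InCopy i Minus p) = (1/2) *\<^sub>R diamond_map (\<lambda>s. x ((1, i) # s)) p"
| "diamond_map x (InPart n p) = diamond_map (\<lambda>s. x ((0, n) # s)) p"

lemma diamond_map_copy_emb:
  assumes "x [] = (1/2) *\<^sub>R (x [(0, i)] + x [(1, i)])"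
  shows "2 *\<^sub>R diamond_map x (copy_emb i Plus p) = x [(1, i)] + diamond_map (\<lambda>s. x ((0, i) # s)) p"
    and "2 *\<^sub>R diamond_map x (copy_emb i Minus p) = diamond_map (\<lambda>s. x ((1, i) # s)) p"
  by (cases p; simp add: assms add.commute)+

lemma diamond_map_part_emb:
  assumes "x [] = x [(0, n)]"
  shows "diamond_map x (part_emb n p) = diamond_map (\<lambda>s. x ((0, n) # s)) p"
  by (cases p; simp add: assms)

text \<open>
  The lower estimate has two sources: pairs of top and bottom of a block use that the nodes of the
  tree are at least \<open>A\<close> in norm, pairs of midpoints use the separation, halved because the midpoints
  are reached along slopes over the length \<open>1/2\<close>.
\<close>

lemma sub_Lipschitz_diamond_map:
  assumes "sprawling_tree \<delta> \<alpha> x" "\<And>s. s \<in> S \<alpha> \<Longrightarrow> A \<le> norm (x s) \<and> norm (x s) \<le> B"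
    and "2 * A \<le> \<delta>"
  shows "sub_Lipschitz \<alpha> A B (diamond_map x)"
  using assms(1,2)
proof (induction \<alpha> arbitrary: x rule: omega1_induct)
  case zero
  then show ?case by (simp add: sub_Lipschitz_zero)
next
  case (osucc \<alpha>)
  note tree = osucc.prems(1)[unfolded sprawling_tree_osucc]
  note bnd = osucc.prems(2)
  have mid: "x [] = (1/2) *\<^sub>R (x [(0, i)] + x [(1, i)])" for i using tree by blast
  have copies: "sub_Lipschitz \<alpha> A B (diamond_map (\<lambda>s. x ((b, i) # s)))" for b i
    using tree bnd by (intro osucc.IH) (simp_all only: Cons_in_S_osucc simp_thms)
  have "sub_Lipschitz \<alpha> A B (\<lambda>p. 2 *\<^sub>R diamond_map x (copy_emb i \<sigma> p))" for i \<sigma>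
    using copies by (cases \<sigma>) (simp_all add: diamond_map_copy_emb mid sub_Lipschitz_translate)
  moreover have "A \<le> norm (diamond_map x (Mid i) - diamond_map x (Mid j)) \<and>
      norm (diamond_map x (Mid i) - diamond_map x (Mid j)) \<le> B" if "i \<noteq> j" for i j
  proof -
    have "x [(1, i)] - x [(1, j)] = x [(0, j)] - x [(0, i)]"
      by (rule midpoint_partner_diff[OF mid mid])
    moreover have "diamond_map x (Mid i) - diamond_map x (Mid j) = (1/2) *\<^sub>R (x [(1, i)] - x [(1, j)])"
      by (simp add: algebra_simps)
    ultimately have eq: "norm (diamond_map x (Mid i) - diamond_map x (Mid j))
        = norm (x [(0, j)] - x [(0, i)]) / 2" by simp
    have "\<delta> \<le> norm (x [(0, j)] - x [(0, i)])"
      using tree[THEN conjunct2, THEN conjunct1, rule_format, OF that[symmetric]] .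
    moreover have "norm (x [(0, k)]) \<le> B" for k
      using bnd[of "[(0, k)]"] by (simp only: Cons_in_S_osucc Nil_in_S)
    then have "norm (x [(0, j)] - x [(0, i)]) \<le> B + B"
      by (meson norm_triangle_ineq4 add_mono order_trans)
    ultimately show ?thesis unfolding eq using assms(3) by simp
  qed
  moreover have "A \<le> norm (x []) \<and> norm (x []) \<le> B" using bnd Nil_in_S by blast
  ultimately show ?case unfolding sub_Lipschitz_osucc by simp
next
  case (limit \<alpha>)
  note tree = limit.prems(1)[unfolded sprawling_tree_limit[OF limit.hyps]]
  have "sub_Lipschitz (\<beta> \<alpha> n) A B (diamond_map (\<lambda>s. x ((0, n) # s)))" for n
    using tree limit.prems(2)
    by (intro limit.IH) (simp_all only: Cons_in_S_limit[OF limit.hyps] simp_thms)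
  then show ?case
    unfolding sub_Lipschitz_limit[OF limit.hyps] using tree by (simp add: diamond_map_part_emb)
qed

section \<open>The index of sprawling trees\<close>

text \<open>
  \<open>S (osucc \<alpha>)\<close> contains copies of \<open>S \<alpha>\<close> above the children of its root, and for a limit
  ordinal \<open>\<alpha>\<close> every \<open>\<gamma> < \<alpha>\<close> occurs in the enumeration, so \<open>S \<alpha>\<close> contains a copy of \<open>S \<gamma>\<close>.
\<close>

lemma contains_sprawling_tree_mono:
  assumes "contains_sprawling_tree K \<delta> \<alpha>" "\<gamma> \<le> \<alpha>"
  shows "contains_sprawling_tree K \<delta> \<gamma>"
  using assms
proof (induction \<alpha> rule: omega1_induct)
  case zero
  have "\<gamma> = 0" using zero.prems(2) zero_le_omega1 by (rule antisym)
  with zero show ?case by simp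
next
  case (osucc \<alpha>)
  show ?case
  proof (cases "\<gamma> = osucc \<alpha>")
    case False
    then have "\<gamma> \<le> \<alpha>" using osucc.prems(2) osucc_le[of \<alpha> \<gamma>] by fastforce
    obtain x where x: "x ` S (osucc \<alpha>) \<subseteq> K" "sprawling_tree \<delta> (osucc \<alpha>) x"
      using osucc.prems(1) unfolding contains_sprawling_tree_def by blast
    have "(\<lambda>s. x ((0, 0) # s)) ` S \<alpha> \<subseteq> K"
      using x(1) Cons_in_S_osucc[of 0 0 _ \<alpha>] by blast
    moreover have "sprawling_tree \<delta> \<alpha> (\<lambda>s. x ((0, 0) # s))"
      using x(2) unfolding sprawling_tree_osucc by blast
    ultimately have "contains_sprawling_tree K \<delta> \<alpha>" unfolding contains_sprawling_tree_def by blast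
    then show ?thesis using osucc.IH \<open>\<gamma> \<le> \<alpha>\<close> by blast
  qed (use osucc.prems in simp)
next
  case (limit \<alpha>)
  show ?case
  proof (cases "\<gamma> = \<alpha>")
    case False
    then have "\<gamma> \<in> range (\<beta> \<alpha>)" using limit.prems(2) range_enumeration[OF limit.hyps] by simp
    then obtain n where n: "\<gamma> = \<beta> \<alpha> n" by blast
    obtain x where x: "x ` S \<alpha> \<subseteq> K" "sprawling_tree \<delta> \<alpha> x"
      using limit.prems(1) unfolding contains_sprawling_tree_def by blast
    have "(\<lambda>s. x ((0, n) # s)) ` S \<gamma> \<subseteq> K"
      using x(1) Cons_in_S_limit[OF limit.hyps, of 0 n] unfolding n by blast
    moreover have "sprawling_tree \<delta> \<gamma> (\<lambda>s. x ((0, n) # s))"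
      using x(2) unfolding sprawling_tree_limit[OF limit.hyps] n by blast
    ultimately show ?thesis unfolding contains_sprawling_tree_def by blast
  qed (use limit.prems in simp)
qed

lemma less_ST_iff:
  "Fin \<alpha> < ST TYPE('a::real_normed_vector) \<longleftrightarrow>
    (\<exists>\<delta>>0. contains_sprawling_tree (cball (0 :: 'a) 1) \<delta> \<alpha>)"
proof -
  have "Fin \<alpha> < ST_delta TYPE('a) \<delta> \<longleftrightarrow> contains_sprawling_tree (cball (0 :: 'a) 1) \<delta> \<alpha>" for \<delta>
  proof
    assume "Fin \<alpha> < ST_delta TYPE('a) \<delta>"
    then have "Fin \<alpha> \<notin> Fin ` {\<gamma>. \<not> contains_sprawling_tree (cball (0 :: 'a) 1) \<delta> \<gamma>}"
      unfolding ST_delta_def by (meson Inf_lower leD)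
    then show "contains_sprawling_tree (cball (0 :: 'a) 1) \<delta> \<alpha>" by blast
  next
    assume C: "contains_sprawling_tree (cball (0 :: 'a) 1) \<delta> \<alpha>"
    have "Fin (osucc \<alpha>) \<le> ST_delta TYPE('a) \<delta>"
      unfolding ST_delta_def
    proof (rule Inf_greatest, safe)
      fix \<gamma> assume "\<not> contains_sprawling_tree (cball (0 :: 'a) 1) \<delta> \<gamma>"
      then have "\<alpha> < \<gamma>" using contains_sprawling_tree_mono[OF C] by (meson not_less)
      then show "Fin (osucc \<alpha>) \<le> Fin \<gamma>" by (simp add: osucc_le)
    qed
    moreover have "Fin \<alpha> < Fin (osucc \<alpha>)"
      using less_osucc[of \<alpha>] by (simp add: less_omega1_inf_def not_le less_imp_le)
    ultimately show "Fin \<alpha> < ST_delta TYPE('a) \<delta>" by simp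
  qed
  then show ?thesis by (auto simp: ST_def less_SUP_iff)
qed

lemma Fin_zero_less_ST: "Fin 0 < ST TYPE('a::real_normed_vector)"
proof -
  have "contains_sprawling_tree (cball (0 :: 'a) 1) 1 0"
    unfolding contains_sprawling_tree_def by (intro exI[of _ "\<lambda>_. 0"]) (auto simp: sprawling_tree_zero)
  then show ?thesis unfolding less_ST_iff by (intro exI[of _ 1]) simp
qed

text \<open>
  For positive \<open>\<alpha>\<close> a tree contains a node with separated children, which provides a nonzero vector
  and thus a vector of norm 2 for the translation.  For \<open>\<alpha> = 0\<close> and the zero space the
  equivalence fails.
\<close>

theorem less_ST_iff_sub_Lipschitz_embeds:
  assumes "0 < \<alpha>"
  shows "Fin \<alpha> < ST TYPE('a::real_normed_vector) \<longleftrightarrow> sub_Lipschitz_embeds \<alpha> TYPE('a)"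
proof
  assume "sub_Lipschitz_embeds \<alpha> TYPE('a)"
  then obtain A B and f :: "point \<Rightarrow> 'a" where AB: "0 < A" "0 < B" "sub_Lipschitz \<alpha> A B f"
    unfolding sub_Lipschitz_embeds_iff by blast
  obtain x :: "(bit \<times> nat) list \<Rightarrow> 'a"
    where x: "\<forall>s\<in>S \<alpha>. norm (x s) \<le> B" "sprawling_tree (2 * A) \<alpha> x"
    using sprawling_tree_from_sub_Lipschitz[OF AB(3)] by blast
  let ?y = "\<lambda>s. 0 + (1/B) *\<^sub>R x s"
  have "sprawling_tree ((1/B) * (2 * A)) \<alpha> ?y"
    using x(2) AB(2) by (intro sprawling_tree_affine) auto
  moreover have "?y ` S \<alpha> \<subseteq> cball 0 1"
    using x(1) AB(2) by (auto simp: field_simps)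
  ultimately have "contains_sprawling_tree (cball (0 :: 'a) 1) ((1/B) * (2 * A)) \<alpha>"
    unfolding contains_sprawling_tree_def by blast
  moreover have "0 < (1/B) * (2 * A)" using AB by simp
  ultimately show "Fin \<alpha> < ST TYPE('a)" unfolding less_ST_iff by blast
next
  assume "Fin \<alpha> < ST TYPE('a)"
  then obtain \<delta> where \<delta>: "0 < \<delta>" "contains_sprawling_tree (cball (0 :: 'a) 1) \<delta> \<alpha>"
    unfolding less_ST_iff by blast
  then obtain x :: "(bit \<times> nat) list \<Rightarrow> 'a" where x: "x ` S \<alpha> \<subseteq> cball 0 1" "sprawling_tree \<delta> \<alpha> x"
    unfolding contains_sprawling_tree_def by blast
  \<comment> \<open>The root itself may have type (C), so pass to the tree of height one to find separated nodes.\<close>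
  have "contains_sprawling_tree (cball (0 :: 'a) 1) \<delta> (osucc 0)"
    by (rule contains_sprawling_tree_mono[OF \<delta>(2) osucc_le[OF assms]])
  then obtain y :: "(bit \<times> nat) list \<Rightarrow> 'a" where "sprawling_tree \<delta> (osucc 0) y"
    unfolding contains_sprawling_tree_def by blast
  then have "\<delta> \<le> norm (y [(0, 0)] - y [(0, 1)])" unfolding sprawling_tree_osucc by simp
  with \<delta>(1) have "norm (y [(0, 0)] - y [(0, 1)]) \<noteq> 0" by linarith
  then obtain z :: 'a where "norm z \<noteq> 0" by blast
  \<comment> \<open>Translating the unit ball by a vector of norm 2 puts it between the norms 1 and 3.\<close>
  define v where "v = (2 / norm z) *\<^sub>R z"
  have v: "norm v = 2" using \<open>norm z \<noteq> 0\<close> by (simp add: v_def)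
  let ?y = "\<lambda>s. v + 1 *\<^sub>R x s"
  have "sprawling_tree (1 * \<delta>) \<alpha> ?y" by (rule sprawling_tree_affine[OF x(2)]) simp
  moreover have "1 \<le> norm (?y s) \<and> norm (?y s) \<le> 3" if "s \<in> S \<alpha>" for s
  proof -
    have "norm (x s) \<le> 1" using x(1) that by auto
    then show ?thesis
      using norm_triangle_ineq[of v "x s"] norm_diff_ineq[of v "x s"] v by simp
  qed
  ultimately have "sub_Lipschitz \<alpha> (min 1 (\<delta> / 2)) 3 (diamond_map ?y)"
    by (intro sub_Lipschitz_diamond_map[of \<delta>]) (auto simp: min_le_iff_disj)
  then show "sub_Lipschitz_embeds \<alpha> TYPE('a)"
    unfolding sub_Lipschitz_embeds_iff using \<delta>(1)
    by (intro exI[of _ "min 1 (\<delta> / 2)"] conjI exI[of _ 3] exI[of _ "diamond_map ?y"]) auto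
qed

text \<open>
  If the inequality failed, \<open>ST\<close> of the target would be a countable ordinal \<open>\<alpha>\<close>, and it would be
  positive as every ball contains a one-point tree.  The diamond of this very ordinal would then
  embed into the source, hence into the target, which forces the target index above \<open>\<alpha>\<close>.
\<close>

theorem ST_mono_bi_Lipschitz:
  assumes "bi_Lipschitz_embeds TYPE('b::real_normed_vector) TYPE('a::real_normed_vector)"
  shows "ST TYPE('b) \<le> ST TYPE('a)"
proof (rule ccontr)
  assume "\<not> ST TYPE('b) \<le> ST TYPE('a)"
  then have less: "ST TYPE('a) < ST TYPE('b)" by simp
  show False
  proof (cases "ST TYPE('a)")
    case Infty
    then show False using less by (simp add: less_omega1_inf_def)
  next
    case (Fin \<alpha>)
    have "\<alpha> \<noteq> 0" using Fin_zero_less_ST[where 'a = 'a] Fin by auto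
    then have "0 < \<alpha>" using zero_le_omega1[of \<alpha>] by simp
    then have "sub_Lipschitz_embeds \<alpha> TYPE('b)"
      using less_ST_iff_sub_Lipschitz_embeds less Fin by metis
    then have "Fin \<alpha> < ST TYPE('a)"
      using sub_Lipschitz_embeds_bi_Lipschitz[OF assms] less_ST_iff_sub_Lipschitz_embeds \<open>0 < \<alpha>\<close>
      by blast
    then show False using Fin by simp
  qed
qed

end

section \<open>Infinite sprawling trees\<close>

definition infinite_sprawling_tree :: "real \<Rightarrow> ((bit \<times> nat) list \<Rightarrow> 'a::real_normed_vector) \<Rightarrow> bool" where
  "infinite_sprawling_tree \<delta> f \<longleftrightarrow>
    (\<forall>s. (\<forall>n. f s = (1/2) *\<^sub>R (f (s @ [(0, n)]) + f (s @ [(1, n)]))) \<and>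
         (\<forall>n m. n \<noteq> m \<longrightarrow> norm (f (s @ [(0, n)]) - f (s @ [(0, m)])) \<ge> \<delta>))"

lemma infinite_sprawling_tree_Cons:
  assumes "infinite_sprawling_tree \<delta> f"
  shows "infinite_sprawling_tree \<delta> (\<lambda>s. f (a # s))"
  using assms unfolding infinite_sprawling_tree_def by (metis append_Cons)

lemma infinite_sprawling_tree_root:
  assumes "infinite_sprawling_tree \<delta> f"
  shows "f [] = (1/2) *\<^sub>R (f [(0, n)] + f [(1, n)])"
    and "n \<noteq> m \<Longrightarrow> \<delta> \<le> norm (f [(0, n)] - f [(0, m)])"
  using assms unfolding infinite_sprawling_tree_def by (metis append_Nil)+

text \<open>
  The infinite tree \<open>y\<close> describes a map on a diamond of infinite depth: a block of size \<open>c\<close> whose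
  bottom is mapped to \<open>w\<close> has its top mapped to \<open>w + c y []\<close>.  Its upper half keeps the top and has
  the midpoint as bottom, its lower half keeps the bottom.  The tree \<open>slope_tree\<close> consists of the
  slopes of this map followed by \<open>g\<close>.
\<close>

primrec slope_tree :: "('b::real_normed_vector \<Rightarrow> 'a::real_normed_vector) \<Rightarrow>
    ((bit \<times> nat) list \<Rightarrow> 'b) \<Rightarrow> 'b \<Rightarrow> real \<Rightarrow> (bit \<times> nat) list \<Rightarrow> 'a" where
  "slope_tree g y w c [] = (1/c) *\<^sub>R (g (w + c *\<^sub>R y []) - g w)"
| "slope_tree g y w c (a # s) =
    slope_tree g (\<lambda>t. y (a # t))
      (if fst a = 0 then w + (c/2) *\<^sub>R y [(1, snd a)] else w) (c/2) s"

lemma slope_tree_bounded: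
  assumes "\<And>u v. norm (g u - g v) \<le> B * norm (u - v)" "0 \<le> B"
    and "0 < c" "\<And>s. norm (y s) \<le> 1"
  shows "norm (slope_tree g y w c s) \<le> B"
  using assms(3,4)
proof (induction s arbitrary: y w c)
  case Nil
  have "norm (g (w + c *\<^sub>R y []) - g w) \<le> B * (c * norm (y []))"
    using assms(1)[of "w + c *\<^sub>R y []" w] Nil(1) by simp
  also have "\<dots> \<le> B * (c * 1)"
    using Nil assms(2) by (intro mult_left_mono) auto
  finally show ?case using Nil(1) by (simp add: pos_divide_le_eq)
next
  case (Cons a s)
  show ?case using Cons.prems by (simp add: Cons.IH)
qed

text \<open>
  The two slopes telescope at the image of the midpoint: their average is the slope of the block
  whatever the value of \<open>g\<close> there.
\<close>

lemma slope_tree_midpoint: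
  assumes "infinite_sprawling_tree \<delta> y"
  shows "slope_tree g y w c s =
    (1/2) *\<^sub>R (slope_tree g y w c (s @ [(0, n)]) + slope_tree g y w c (s @ [(1, n)]))"
  using assms
proof (induction s arbitrary: y w c)
  case Nil
  have "w + c *\<^sub>R y [] = w + (c/2) *\<^sub>R y [(1, n)] + (c/2) *\<^sub>R y [(0, n)]"
    by (subst infinite_sprawling_tree_root(1)[OF Nil, of n]) (simp add: algebra_simps)
  then show ?case by (simp add: algebra_simps)
next
  case (Cons a s)
  show ?case
    using Cons.IH[OF infinite_sprawling_tree_Cons[OF Cons.prems]] by simp
qed

text \<open>
  The upper halves through two midpoints share their top, so only the images of the midpoints remain
  in the difference of the slopes, and \<open>g\<close> keeps these apart.
\<close>

lemma slope_tree_separated: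
  assumes "\<And>u v. A * norm (u - v) \<le> norm (g u - g v)" "0 \<le> A"
    and "infinite_sprawling_tree \<delta> y" "0 < c" "n \<noteq> m"
  shows "A * \<delta> \<le> norm (slope_tree g y w c (s @ [(0, n)]) - slope_tree g y w c (s @ [(0, m)]))"
  using assms(3,4)
proof (induction s arbitrary: y w c)
  case Nil
  note root = infinite_sprawling_tree_root[OF Nil(1)]
  \<comment> \<open>the midpoints of the block\<close>
  define M where "M k = w + (c/2) *\<^sub>R y [(1, k)]" for k
  have top: "M k + (c/2) *\<^sub>R y [(0, k)] = w + c *\<^sub>R y []" for k
    by (subst root(1)[of k]) (simp add: M_def algebra_simps)
  have val: "slope_tree g y w c ([] @ [(0, k)]) = (2/c) *\<^sub>R (g (w + c *\<^sub>R y []) - g (M k))" for k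
    by (simp add: top[unfolded M_def] M_def)
  have "y [(1, m)] - y [(1, n)] = y [(0, n)] - y [(0, m)]"
    by (rule midpoint_partner_diff[OF root(1) root(1)])
  moreover have "M m - M n = (c/2) *\<^sub>R (y [(1, m)] - y [(1, n)])"
    by (simp add: M_def algebra_simps)
  ultimately have "norm (M m - M n) = (c/2) * norm (y [(0, n)] - y [(0, m)])"
    using Nil(2) by simp
  then have "(c/2) * \<delta> \<le> norm (M m - M n)" using root(2)[OF assms(5)] Nil(2) by simp
  then have le: "A * ((c/2) * \<delta>) \<le> norm (g (M m) - g (M n))"
    using assms(1)[of "M m" "M n"] assms(2) by (meson mult_left_mono order_trans)
  have D: "slope_tree g y w c ([] @ [(0, n)]) - slope_tree g y w c ([] @ [(0, m)])
      = (2/c) *\<^sub>R (g (M m) - g (M n))"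
    unfolding val by (simp add: algebra_simps)
  show ?case unfolding D norm_scaleR using le Nil(2) by (simp add: field_simps)
next
  case (Cons a s)
  show ?case
    using Cons.IH[OF infinite_sprawling_tree_Cons[OF Cons.prems(1)]] Cons.prems(2) by simp
qed

theorem infinite_sprawling_tree_property_bi_Lipschitz:
  assumes "bi_Lipschitz_embeds TYPE('b::real_normed_vector) TYPE('a::real_normed_vector)"
    and "infinite_sprawling_tree_property TYPE('b)"
  shows "infinite_sprawling_tree_property TYPE('a)"
proof -
  obtain A B and g :: "'b \<Rightarrow> 'a" where g: "0 < A" "0 < B"
    "\<And>u v. A * norm (u - v) \<le> norm (g u - g v)" "\<And>u v. norm (g u - g v) \<le> B * norm (u - v)"
    using assms(1) unfolding bi_Lipschitz_embeds_def dist_norm by blast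
  obtain \<delta> and y :: "(bit \<times> nat) list \<Rightarrow> 'b" where y: "0 < \<delta>" "range y \<subseteq> cball 0 1"
    "infinite_sprawling_tree \<delta> y"
    using assms(2) unfolding infinite_sprawling_tree_property_def infinite_sprawling_tree_def
    by blast
  define x where "x s = (1/B) *\<^sub>R slope_tree g y 0 1 s" for s
  have "norm (y s) \<le> 1" for s using y(2) by (simp add: image_subset_iff)
  then have "norm (slope_tree g y 0 1 s) \<le> B" for s
    using slope_tree_bounded[of g B 1 y] g by simp
  then have "range x \<subseteq> cball 0 1" using g(2) by (auto simp: x_def field_simps)
  moreover have "x s = (1/2) *\<^sub>R (x (s @ [(0, n)]) + x (s @ [(1, n)]))" for s n
    unfolding x_def by (subst slope_tree_midpoint[OF y(3), of g 0 1 s n]) (simp add: algebra_simps)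
  moreover have "A * \<delta> / B \<le> norm (x (s @ [(0, n)]) - x (s @ [(0, m)]))" if "n \<noteq> m" for s n m
  proof -
    have "x (s @ [(0, n)]) - x (s @ [(0, m)]) =
        (1/B) *\<^sub>R (slope_tree g y 0 1 (s @ [(0, n)]) - slope_tree g y 0 1 (s @ [(0, m)]))"
      by (simp add: x_def algebra_simps)
    then show ?thesis
      using slope_tree_separated[OF g(3) _ y(3) _ that, of 1 0 s] g(1,2)
      by (simp add: divide_right_mono)
  qed
  moreover have "0 < A * \<delta> / B" using g y by simp
  ultimately show ?thesis unfolding infinite_sprawling_tree_property_def by blast
qed

theorem theorem1p2:
  fixes \<beta> :: "omega1 \<Rightarrow> nat \<Rightarrow> omega1" and \<alpha> :: omega1
  assumes "limit_enumeration \<beta>"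
    and "separable_space (euclidean :: 'x::banach topology)"
    and "0 < \<alpha>"
    and "bi_Lipschitz_embeds TYPE('y::banach) TYPE('x)"
  shows "(limit_enumeration.ST \<beta> TYPE('x) > Fin \<alpha>
            \<longleftrightarrow> limit_enumeration.sub_Lipschitz_embeds \<beta> \<alpha> TYPE('x))
       \<and> limit_enumeration.ST \<beta> TYPE('y) \<le> limit_enumeration.ST \<beta> TYPE('x)
       \<and> (\<not> infinite_sprawling_tree_property TYPE('x)
            \<longrightarrow> \<not> infinite_sprawling_tree_property TYPE('y))"
proof -
  interpret limit_enumeration \<beta> by (rule assms(1))
  show ?thesis
    using less_ST_iff_sub_Lipschitz_embeds[OF assms(3)] ST_mono_bi_Lipschitz[OF assms(4)]
      infinite_sprawling_tree_property_bi_Lipschitz[OF assms(4)]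
    by blast
qed

end
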